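(* For integers $1\le M\le N$ let $\mathrm{THRESHOLD}_M:\{0,1\}^N\to\{0,1\}$ be the function that is 1 on $X$ if and only if $X$ contains at least $M$ 1s. Then $Q_2(\mathrm{THRESHOLD}_M)\in\Theta\big(\sqrt{M(N-M+1)}\big)$, i.e. there are absolute constants $c_1,c_2>0$ such that for all integers $1\le M\le N$, $$c_1\sqrt{M(N-M+1)}\le Q_2(\mathrm{THRESHOLD}_M)\le c_2\sqrt{M(N-M+1)}.$$
   Context: Quantum networks: the input $X=(x_0,\ldots,x_{N-1})\in\{0,1\}^N$ is given as a black-box. A quantum network with $T$ queries acts on $m$ qubits (for some $m$) and is a sequence of unitary transformations $U_0,O,U_1,O,\ldots,U_{T-1},O,U_T$ applied in this order to the initial state $|0\rangle$, where the $U_j$ are arbitrary unitaries on $m$ qubits not depending on $X$, and the query $O$ (depending on $X$) maps each basis state $|i,b,z\rangle$ to $|i,b\oplus x_i,z\rangle$; here $i$ consists of $\lceil\log_2 N\rceil$ bits, $b$ is one bit, and $z$ consists of the remaining $m-\lceil\log_2 N\rceil-1$ bits (if $i\ge N$, the query leaves the basis state unchanged). The output is the value obtained by measuring the rightmost bit of the final state in the computational basis. The network computes $f$ with bounded error if for every $X\in\{0,1\}^N$ the output equals $f(X)$ with probability at least $2/3$. $Q_2(f)$ is the minimum $T$ such that some quantum network with $T$ queries computes $f$ with bounded error. *)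

theory Defs
  imports Complex_Main "Jordan_Normal_Form.Schur_Decomposition"
begin

definition unitary_mat :: "nat \<Rightarrow> complex mat \<Rightarrow> bool" where
  "unitary_mat d U \<longleftrightarrow> U \<in> carrier_mat d d \<and>
     mat_adjoint U * U = 1\<^sub>m d \<and> U * mat_adjoint U = 1\<^sub>m d"

definition index_bits :: "nat \<Rightarrow> nat" where
  "index_bits N = nat \<lceil>log 2 (real N)\<rceil>"

text \<open>The computational basis states of \<open>m\<close> qubits are numbered by \<open>k < 2 ^ m\<close>, the leftmost
  qubit being the most significant binary digit of \<open>k\<close>.  Hence, writing
  \<open>w = m - index_bits N - 1\<close> for the number of workspace bits, the state \<open>|i,b,z\<rangle>\<close> has number
  \<open>i * 2 ^ (w + 1) + b * 2 ^ w + z\<close>.\<close>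

definition basis_num :: "nat \<Rightarrow> nat \<Rightarrow> bool \<Rightarrow> nat \<Rightarrow> nat" where
  "basis_num w i b z = i * 2 ^ (w + 1) + of_bool b * 2 ^ w + z"

definition query_basis :: "nat \<Rightarrow> bool list \<Rightarrow> nat \<Rightarrow> nat" where
  "query_basis w X k =
    (let i = k div 2 ^ (w + 1); b = odd (k div 2 ^ w); z = k mod 2 ^ w
     in if i < length X then basis_num w i (b \<noteq> X ! i) z else k)"

definition query_mat :: "nat \<Rightarrow> bool list \<Rightarrow> complex mat" where
  "query_mat m X = mat (2 ^ m) (2 ^ m)
    (\<lambda>(r, c). if r = query_basis (m - index_bits (length X) - 1) X c then 1 else 0)"

fun network_state :: "nat \<Rightarrow> (nat \<Rightarrow> complex mat) \<Rightarrow> bool list \<Rightarrow> nat \<Rightarrow> complex vec" where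
  "network_state m U X 0 = U 0 *\<^sub>v unit_vec (2 ^ m) 0"
| "network_state m U X (Suc t) = U (Suc t) *\<^sub>v (query_mat m X *\<^sub>v network_state m U X t)"

definition output_prob :: "nat \<Rightarrow> complex vec \<Rightarrow> bool \<Rightarrow> real" where
  "output_prob m \<psi> v = (\<Sum>k | k < 2 ^ m \<and> odd k = v. (cmod (\<psi> $ k))\<^sup>2)"

text \<open>Only \<open>U 0, \<dots>, U T\<close> matter; the values of \<open>U\<close> beyond \<open>T\<close> are irrelevant.\<close>

definition quantum_network :: "nat \<Rightarrow> nat \<Rightarrow> nat \<Rightarrow> (nat \<Rightarrow> complex mat) \<Rightarrow> bool" where
  "quantum_network N m T U \<longleftrightarrow>
     index_bits N + 1 \<le> m \<and> (\<forall>j\<le>T. unitary_mat (2 ^ m) (U j))"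

definition computes_bounded_error ::
  "nat \<Rightarrow> (bool list \<Rightarrow> bool) \<Rightarrow> nat \<Rightarrow> nat \<Rightarrow> (nat \<Rightarrow> complex mat) \<Rightarrow> bool" where
  "computes_bounded_error N f m T U \<longleftrightarrow>
     (\<forall>X. length X = N \<longrightarrow> output_prob m (network_state m U X T) (f X) \<ge> 2 / 3)"

definition Q2 :: "nat \<Rightarrow> (bool list \<Rightarrow> bool) \<Rightarrow> nat" where
  "Q2 N f = (LEAST T. \<exists>m U. quantum_network N m T U \<and> computes_bounded_error N f m T U)"

definition THRESHOLD :: "nat \<Rightarrow> bool list \<Rightarrow> bool" where
  "THRESHOLD M X \<longleftrightarrow> M \<le> count_list X True"

lemma query_basis_basis_num:
  assumes "z < 2 ^ w"
  shows "query_basis w X (basis_num w i b z) =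
    (if i < length X then basis_num w i (b \<noteq> X ! i) z else basis_num w i b z)"
proof -
  have k: "basis_num w i b z = z + 2 ^ w * (2 * i + of_bool b)"
    by (simp add: basis_num_def algebra_simps)
  have d: "basis_num w i b z div 2 ^ w = 2 * i + of_bool b"
    using assms unfolding k by simp
  have "basis_num w i b z div 2 ^ (w + 1) = basis_num w i b z div 2 ^ w div 2"
    by (simp only: power_add power_one_right div_mult2_eq)
  then have i: "basis_num w i b z div 2 ^ (w + 1) = i"
    unfolding d by simp
  have z: "basis_num w i b z mod 2 ^ w = z"
    using assms unfolding k by simp
  show ?thesis
    unfolding query_basis_def Let_def i d z by simp
qed

lemma query_mat_unit_vec:
  assumes "k < 2 ^ m"
  shows "query_mat m X *\<^sub>v unit_vec (2 ^ m) k =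
    unit_vec (2 ^ m) (query_basis (m - index_bits (length X) - 1) X k)"
  using assms by (intro eq_vecI) (auto simp: query_mat_def unit_vec_def[of _ "query_basis _ _ _"])

end

theory Submission
  imports Defs
begin

text \<open>Lower bound: the adversary method. Relate every input of weight \<open>M - 1\<close> to the
  \<open>N - M + 1\<close> inputs of weight \<open>M\<close> obtained by flipping one bit. The sum of the inner products of
  related states starts at the number of related pairs, must have dropped by a constant fraction at
  the end, and drops by at most a fraction \<open>2 / sqrt (M * (N - M + 1))\<close> with each query.

  Upper bound: Grover's iteration rotates by an angle whose cosine is \<open>c = 1 - 2 * k / N\<close>, where
  \<open>k\<close> is the weight of the input. Run it \<open>t\<close> times in superposition over \<open>t = 1, \<dots>, T\<close>, with
  amplitudes the sine vector \<open>sin (\<pi> * t / (T + 1))\<close>, and measure \<open>t\<close> in the eigenbasis (discrete sine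
  transform) of the path on \<open>T\<close> vertices. The three-term recurrence of the rotation makes the
  state an approximate eigenvector for the eigenvalue \<open>c\<close>; the mean squared deviation of the
  measured eigenvalue from \<open>c\<close> is \<open>O(1 / T^4 + (1 - c\<^sup>2) / T\<^sup>2)\<close>, and Chebyshev's inequality
  shows that \<open>T = O(sqrt (M * (N - M + 1)))\<close> suffices to tell \<open>k < M\<close> from \<open>k \<ge> M\<close>.\<close>

section \<open>The query permutation\<close>

text \<open>The index register can hold every \<open>i < N\<close>; this keeps the basis numbers of
  realised states below \<open>2 ^ m\<close>.\<close>

lemma le_two_power_index_bits: "N \<le> 2 ^ index_bits N"
proof (cases "N = 0")
  case False
  have "real N = 2 powr log 2 (real N)"
    using False by simp
  also have "\<dots> \<le> 2 powr real (index_bits N)"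
    unfolding index_bits_def by (intro powr_mono) linarith+
  also have "\<dots> = real (2 ^ index_bits N)"
    by (simp add: powr_realpow)
  finally show ?thesis
    by linarith
qed simp

lemma basis_num_decomp:
  "basis_num w (k div 2 ^ (w + 1)) (odd (k div 2 ^ w)) (k mod 2 ^ w) = k"
proof -
  have "k div 2 ^ (w + 1) = k div 2 ^ w div 2"
    by (simp only: power_add power_one_right div_mult2_eq)
  then have "k div 2 ^ (w + 1) * 2 + of_bool (odd (k div 2 ^ w)) = k div 2 ^ w"
    by (simp add: mod_2_eq_odd [symmetric])
  moreover have "basis_num w (k div 2 ^ (w + 1)) (odd (k div 2 ^ w)) (k mod 2 ^ w)
      = (k div 2 ^ (w + 1) * 2 + of_bool (odd (k div 2 ^ w))) * 2 ^ w + k mod 2 ^ w"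
    by (simp add: basis_num_def algebra_simps)
  ultimately show ?thesis
    by (metis div_mult_mod_eq)
qed

lemma basis_num_div:
  assumes "z < 2 ^ w"
  shows "basis_num w i b z div 2 ^ (w + 1) = i"
proof -
  have k: "basis_num w i b z = z + 2 ^ w * (2 * i + of_bool b)"
    by (simp add: basis_num_def algebra_simps)
  have "basis_num w i b z div 2 ^ (w + 1) = basis_num w i b z div 2 ^ w div 2"
    by (simp only: power_add power_one_right div_mult2_eq)
  also have "basis_num w i b z div 2 ^ w = 2 * i + of_bool b"
    using assms unfolding k by simp
  finally show ?thesis
    by simp
qed

lemma basis_num_inject:
  assumes "z < 2 ^ w" "z' < 2 ^ w" "basis_num w i b z = basis_num w i' b' z'"
  shows "i = i'" "b = b'" "z = z'"
proof -
  have k: "basis_num w i b z = z + 2 ^ w * (2 * i + of_bool b)" for i b z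
    by (simp add: basis_num_def algebra_simps)
  have m: "basis_num w i b z mod 2 ^ w = z" if "z < 2 ^ w" for i b z
    using that unfolding k by simp
  have d: "basis_num w i b z div 2 ^ w = 2 * i + of_bool b" if "z < 2 ^ w" for i b z
    using that unfolding k by simp
  show "z = z'"
    using assms m by metis
  show i: "i = i'"
    using assms basis_num_div by metis
  have "2 * i + of_bool b = 2 * i' + of_bool b'"
    using assms d by metis
  with i show "b = b'"
    by (cases b; cases b') auto
qed

lemma query_basis_cases:
  obtains i b z where "k = basis_num w i b z" "z < 2 ^ w" "i = k div 2 ^ (w + 1)"
    "query_basis w X k = (if i < length X then basis_num w i (b \<noteq> X ! i) z else k)"
proof (rule that)
  show "k = basis_num w (k div 2 ^ (w + 1)) (odd (k div 2 ^ w)) (k mod 2 ^ w)"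
    by (simp only: basis_num_decomp)
qed (simp_all add: query_basis_def Let_def)

lemma query_basis_div: "query_basis w X k div 2 ^ (w + 1) = k div 2 ^ (w + 1)"
  by (rule query_basis_cases [of k w X]) (metis basis_num_div)

lemma query_basis_involution: "query_basis w X (query_basis w X k) = k"
proof (rule query_basis_cases [of k w X])
  fix i b z
  assume "k = basis_num w i b z" "z < 2 ^ w"
  then show ?thesis
    by (cases b; cases "X ! i") (auto simp: query_basis_basis_num)
qed

text \<open>A query reads only the bit named by the index register, so inputs that differ in one
  position act alike on all other blocks. This localises the effect of a query in the adversary
  argument.\<close>

lemma query_basis_cong:
  assumes "length X = length Y" "X ! (k div 2 ^ (w + 1)) = Y ! (k div 2 ^ (w + 1))"
  shows "query_basis w X k = query_basis w Y k"
  using assms by (simp add: query_basis_def Let_def)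

lemma query_basis_less:
  assumes "w + 1 \<le> m" "k < 2 ^ m"
  shows "query_basis w X k < 2 ^ m"
proof -
  have m: "(2::nat) ^ m = 2 ^ (m - (w + 1)) * 2 ^ (w + 1)"
    using assms(1) by (simp only: power_add [symmetric]) simp
  have "query_basis w X k div 2 ^ (w + 1) < 2 ^ (m - (w + 1))"
    unfolding query_basis_div using assms(2) unfolding m by (simp add: less_mult_imp_div_less)
  then show ?thesis
    unfolding m by (subst (asm) div_less_iff_less_mult) simp_all
qed

lemma dim_query_mat [simp]: "dim_row (query_mat m X) = 2 ^ m" "dim_col (query_mat m X) = 2 ^ m"
  by (simp_all add: query_mat_def)

text \<open>A permutation matrix reads entry \<open>k\<close> from the preimage of \<open>k\<close>;
  the query permutation is its own inverse, so the preimage is \<open>query_basis\<close>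
  again.\<close>

lemma query_mat_mult_vec:
  assumes "index_bits (length X) + 1 \<le> m" "dim_vec v = 2 ^ m" "k < 2 ^ m"
  shows "(query_mat m X *\<^sub>v v) $ k = v $ query_basis (m - index_bits (length X) - 1) X k"
proof -
  define q where "q = query_basis (m - index_bits (length X) - 1) X"
  have q: "q k < 2 ^ m"
    unfolding q_def using assms by (intro query_basis_less) auto
  have inv: "k = q c \<longleftrightarrow> c = q k" for c
    unfolding q_def by (metis query_basis_involution)
  have "(query_mat m X *\<^sub>v v) $ k = (\<Sum>c<2 ^ m. (if k = q c then 1 else 0) * v $ c)"
    using assms by (simp add: query_mat_def scalar_prod_def lessThan_atLeast0 q_def)
  also have "\<dots> = (\<Sum>c<2 ^ m. if c = q k then v $ c else 0)"
    by (intro sum.cong) (auto simp: inv)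
  also have "\<dots> = v $ q k"
    using q by simp
  finally show ?thesis
    unfolding q_def .
qed

section \<open>The adversary lower bound\<close>

definition inner_vec :: "complex vec \<Rightarrow> complex vec \<Rightarrow> complex" where
  "inner_vec p q = (\<Sum>k<dim_vec p. cnj (p $ k) * q $ k)"

lemma inner_vec_self: "inner_vec p p = of_real (\<Sum>k<dim_vec p. (cmod (p $ k))\<^sup>2)"
  by (simp add: inner_vec_def complex_norm_square mult.commute del: of_real_power)

lemma mat_adjoint_index:
  assumes "A \<in> carrier_mat d d" "i < d" "j < d"
  shows "mat_adjoint A $$ (i, j) = cnj (A $$ (j, i))"
  using assms by (simp add: mat_adjoint_def mat_of_rows_def)

lemma unitary_mat_columns:
  assumes "unitary_mat d U" "a < d" "b < d"
  shows "(\<Sum>k<d. cnj (U $$ (k, a)) * U $$ (k, b)) = (if a = b then 1 else 0)"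
proof -
  have U: "U \<in> carrier_mat d d"
    using assms(1) by (simp add: unitary_mat_def)
  have adj: "dim_row (mat_adjoint U) = d" "dim_col (mat_adjoint U) = d"
    using U by (auto simp: mat_adjoint_def)
  have "(\<Sum>k<d. cnj (U $$ (k, a)) * U $$ (k, b)) = (mat_adjoint U * U) $$ (a, b)"
    using U assms(2,3) adj
    by (simp add: scalar_prod_def lessThan_atLeast0 mat_adjoint_index [OF U])
  also have "\<dots> = (if a = b then 1 else 0)"
    using assms by (simp add: unitary_mat_def)
  finally show ?thesis .
qed

lemma mult_mat_vec_index:
  assumes "A \<in> carrier_mat d d" "dim_vec v = d" "k < d"
  shows "(A *\<^sub>v v) $ k = (\<Sum>a<d. A $$ (k, a) * v $ a)"
  using assms by (simp add: scalar_prod_def lessThan_atLeast0)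

lemma inner_vec_unitary:
  assumes U: "unitary_mat d U" and p: "dim_vec p = d" and q: "dim_vec q = d"
  shows "inner_vec (U *\<^sub>v p) (U *\<^sub>v q) = inner_vec p q"
proof -
  have C: "U \<in> carrier_mat d d"
    using U by (simp add: unitary_mat_def)
  have "inner_vec (U *\<^sub>v p) (U *\<^sub>v q)
      = (\<Sum>k<d. (\<Sum>a<d. cnj (U $$ (k, a)) * cnj (p $ a)) * (\<Sum>b<d. U $$ (k, b) * q $ b))"
    using C unfolding inner_vec_def
    by (auto simp: mult_mat_vec_index [OF C p] mult_mat_vec_index [OF C q] simp del: index_mult_mat_vec intro!: sum.cong)
  also have "\<dots> = (\<Sum>k<d. \<Sum>a<d. \<Sum>b<d.
      cnj (p $ a) * q $ b * (cnj (U $$ (k, a)) * U $$ (k, b)))"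
    unfolding sum_product by (simp add: mult_ac)
  \<comment> \<open>Two swaps move the sum over \<open>k\<close> innermost, where orthonormality of
    the columns of \<open>U\<close> applies.\<close>
  also have "\<dots> = (\<Sum>a<d. \<Sum>b<d. cnj (p $ a) * q $ b * (\<Sum>k<d. cnj (U $$ (k, a)) * U $$ (k, b)))"
    unfolding sum_distrib_left
    by (rule trans [OF sum.swap sum.cong [OF refl sum.swap]])
  also have "\<dots> = (\<Sum>a<d. \<Sum>b<d. if b = a then cnj (p $ a) * q $ b else 0)"
    using U by (intro sum.cong refl) (auto simp: unitary_mat_columns)
  also have "\<dots> = inner_vec p q"
    using p by (simp add: inner_vec_def)
  finally show ?thesis .
qed

text \<open>The probability of finding \<open>i\<close> in the index register, that is, the weight
  with which the next query reads bit \<open>i\<close>.\<close>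

definition index_mass :: "nat \<Rightarrow> nat \<Rightarrow> complex vec \<Rightarrow> real" where
  "index_mass w i p = (\<Sum>k | k < dim_vec p \<and> k div 2 ^ (w + 1) = i. (cmod (p $ k))\<^sup>2)"

lemma sum_index_mass_le:
  assumes "finite S"
  shows "(\<Sum>i\<in>S. index_mass w i p) \<le> (\<Sum>k<dim_vec p. (cmod (p $ k))\<^sup>2)"
proof -
  have "(\<Sum>i\<in>S. index_mass w i p)
      = (\<Sum>k | k < dim_vec p \<and> k div 2 ^ (w + 1) \<in> S. (cmod (p $ k))\<^sup>2)"
    unfolding index_mass_def
    using assms
    by (subst sum.group [of _ S "\<lambda>k. k div 2 ^ (w + 1)", symmetric])
       (auto intro!: sum.cong)
  also have "\<dots> \<le> (\<Sum>k<dim_vec p. (cmod (p $ k))\<^sup>2)"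
    by (intro sum_mono2) auto
  finally show ?thesis .
qed

text \<open>The query permutes the states inside each index block, so it permutes every set cut out
  by a condition on the index.\<close>

lemma sum_query_basis:
  fixes g :: "nat \<Rightarrow> 'a :: comm_monoid_add"
  assumes "w + 1 \<le> m"
  shows "(\<Sum>k | k < 2 ^ m \<and> P (k div 2 ^ (w + 1)). g (query_basis w X k))
       = (\<Sum>k | k < 2 ^ m \<and> P (k div 2 ^ (w + 1)). g k)"
  by (rule sum.reindex_bij_witness [of _ "query_basis w X" "query_basis w X"])
     (use assms in \<open>auto simp: query_basis_involution query_basis_less query_basis_div [simplified]\<close>)

text \<open>Arithmetic-geometric mean inequality with a free weight. It stands in for
  Cauchy-Schwarz; the weight is later fitted to the degrees of the adversary relation and to the
  error probability.\<close>

lemma mult_le_weighted_squares: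
  fixes a b c :: real
  assumes "c > 0"
  shows "a * b \<le> (c * a\<^sup>2 + b\<^sup>2 / c) / 2"
proof -
  have "0 \<le> (c * a - b)\<^sup>2 / c"
    using assms by simp
  also have "\<dots> = c * a\<^sup>2 + b\<^sup>2 / c - 2 * (a * b)"
    using assms by (simp add: field_simps power2_eq_square)
  finally show ?thesis
    by simp
qed

text \<open>Outside block \<open>i\<close> both queries are the same permutation, so those
  contributions cancel. What remains is block \<open>i\<close> after the query minus block
  \<open>i\<close> before it, and each of the two costs half of the bound.\<close>

lemma inner_vec_query_diff:
  fixes c :: real
  assumes N: "length X = N" "length Y = N" and m: "index_bits N + 1 \<le> m"
    and agree: "\<And>j. j \<noteq> i \<Longrightarrow> X ! j = Y ! j"
    and p: "dim_vec p = 2 ^ m" and q: "dim_vec q = 2 ^ m" and c: "c > 0"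
  defines "w \<equiv> m - index_bits N - 1"
  shows "cmod (inner_vec (query_mat m X *\<^sub>v p) (query_mat m Y *\<^sub>v q) - inner_vec p q)
      \<le> c * index_mass w i p + index_mass w i q / c"
proof -
  have w: "w + 1 \<le> m"
    unfolding w_def using m by simp
  define D where "D = {..<(2::nat) ^ m}"
  define I where "I = {k. k < 2 ^ m \<and> k div 2 ^ (w + 1) = i}"
  define J where "J = {k. k < 2 ^ m \<and> k div 2 ^ (w + 1) \<noteq> i}"
  have IJ: "D = I \<union> J" "I \<inter> J = {}" "finite I" "finite J"
    by (auto simp: I_def J_def D_def)
  define g where "g k = cnj (p $ query_basis w X k) * q $ query_basis w Y k" for k
  define h where "h k = cnj (p $ k) * q $ k" for k
  have "inner_vec (query_mat m X *\<^sub>v p) (query_mat m Y *\<^sub>v q) = sum g D"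
    unfolding inner_vec_def g_def D_def using N m p q
    by (auto simp: query_mat_mult_vec w_def simp del: index_mult_mat_vec intro!: sum.cong)
  moreover have "inner_vec p q = sum h D"
    unfolding inner_vec_def h_def D_def using p by simp
  moreover have "sum g J = sum h J"
  proof -
    have "sum g J = (\<Sum>k\<in>J. h (query_basis w X k))"
      using N agree by (intro sum.cong) (auto simp: g_def h_def J_def intro!: arg_cong [of _ _ "($) q"] query_basis_cong)
    also have "\<dots> = sum h J"
      unfolding J_def using w by (rule sum_query_basis)
    finally show ?thesis .
  qed
  ultimately have "inner_vec (query_mat m X *\<^sub>v p) (query_mat m Y *\<^sub>v q) - inner_vec p q
      = sum g I - sum h I"
    using IJ by (simp add: sum.union_disjoint)
  moreover have "cmod (sum h I) \<le> (c * index_mass w i p + index_mass w i q / c) / 2"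
  proof -
    have "cmod (sum h I) \<le> (\<Sum>k\<in>I. cmod (p $ k) * cmod (q $ k))"
      by (intro sum_norm_le) (simp add: h_def norm_mult)
    also have "\<dots> \<le> (\<Sum>k\<in>I. (c * (cmod (p $ k))\<^sup>2 + (cmod (q $ k))\<^sup>2 / c) / 2)"
      using c by (intro sum_mono mult_le_weighted_squares)
    also have "\<dots> = (c * index_mass w i p + index_mass w i q / c) / 2"
      unfolding index_mass_def p q I_def
      by (simp add: sum.distrib sum_distrib_left flip: sum_divide_distrib)
    finally show ?thesis .
  qed
  moreover have "cmod (sum g I) \<le> (c * index_mass w i p + index_mass w i q / c) / 2"
  proof -
    have r: "(\<Sum>k\<in>I. (cmod (v $ query_basis w Z k))\<^sup>2) = (\<Sum>k\<in>I. (cmod (v $ k))\<^sup>2)" for v Z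
      unfolding I_def using sum_query_basis [OF w, where P = "\<lambda>x. x = i" and X = Z] by simp
    have "cmod (sum g I) \<le> (\<Sum>k\<in>I. cmod (p $ query_basis w X k) * cmod (q $ query_basis w Y k))"
      by (intro sum_norm_le) (simp add: g_def norm_mult)
    also have "\<dots> \<le> (\<Sum>k\<in>I. (c * (cmod (p $ query_basis w X k))\<^sup>2
        + (cmod (q $ query_basis w Y k))\<^sup>2 / c) / 2)"
      using c by (intro sum_mono mult_le_weighted_squares)
    also have "\<dots> = (c * (\<Sum>k\<in>I. (cmod (p $ query_basis w X k))\<^sup>2)
        + (\<Sum>k\<in>I. (cmod (q $ query_basis w Y k))\<^sup>2) / c) / 2"
      by (simp add: sum.distrib sum_distrib_left flip: sum_divide_distrib)
    also have "\<dots> = (c * index_mass w i p + index_mass w i q / c) / 2"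
      unfolding r unfolding index_mass_def p q I_def ..
    finally show ?thesis .
  qed
  ultimately show ?thesis
    using norm_triangle_ineq4 [of "sum g I" "sum h I"] by simp
qed

lemma inner_vec_query:
  assumes "index_bits (length X) + 1 \<le> m" "dim_vec p = 2 ^ m" "dim_vec q = 2 ^ m"
  shows "inner_vec (query_mat m X *\<^sub>v p) (query_mat m X *\<^sub>v q) = inner_vec p q"
proof -
  define w where "w = m - index_bits (length X) - 1"
  have w: "w + 1 \<le> m"
    unfolding w_def using assms by simp
  have "inner_vec (query_mat m X *\<^sub>v p) (query_mat m X *\<^sub>v q)
      = (\<Sum>k<2 ^ m. cnj (p $ query_basis w X k) * q $ query_basis w X k)"
    unfolding inner_vec_def using assms
    by (auto simp: query_mat_mult_vec w_def simp del: index_mult_mat_vec intro!: sum.cong)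
  also have "\<dots> = inner_vec p q"
    using sum_query_basis [OF w, where P = "\<lambda>_. True" and X = X and g = "\<lambda>k. cnj (p $ k) * q $ k"]
    by (simp add: inner_vec_def assms lessThan_def)
  finally show ?thesis .
qed

section \<open>Evolution of the states of a network\<close>

context
  fixes N m T :: nat and U :: "nat \<Rightarrow> complex mat"
  assumes network: "quantum_network N m T U"
begin

lemma network_unitary: "j \<le> T \<Longrightarrow> unitary_mat (2 ^ m) (U j)"
  using network by (simp add: quantum_network_def)

lemma dim_network_state [simp]: "t \<le> T \<Longrightarrow> dim_vec (network_state m U X t) = 2 ^ m"
  using network_unitary [of t] by (cases t) (auto simp: unitary_mat_def)

lemma inner_vec_network_state_0:
  "inner_vec (network_state m U X 0) (network_state m U Y 0) = 1"
proof -
  have "inner_vec (network_state m U X 0) (network_state m U Y 0)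
      = inner_vec (unit_vec (2 ^ m) 0) (unit_vec (2 ^ m) 0)"
    using network_unitary [of 0] by (simp add: inner_vec_unitary)
  also have "\<dots> = (\<Sum>k<(2::nat) ^ m. if k = 0 then 1 else 0)"
    unfolding inner_vec_def by (intro sum.cong) (auto simp: unit_vec_def)
  finally show ?thesis
    by simp
qed

lemma inner_vec_network_state_Suc:
  assumes "Suc t \<le> T"
  shows "inner_vec (network_state m U X (Suc t)) (network_state m U Y (Suc t))
    = inner_vec (query_mat m X *\<^sub>v network_state m U X t) (query_mat m Y *\<^sub>v network_state m U Y t)"
  using network_unitary [OF assms] by (simp add: inner_vec_unitary)

lemma network_state_norm:
  assumes "length X = N" "t \<le> T"
  shows "(\<Sum>k<2 ^ m. (cmod (network_state m U X t $ k))\<^sup>2) = 1"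
proof -
  have "inner_vec (network_state m U X t) (network_state m U X t) = 1"
    using assms(2)
  proof (induction t)
    case 0
    show ?case
      by (rule inner_vec_network_state_0)
  next
    case (Suc t)
    then show ?case
      using network assms(1)
      by (subst inner_vec_network_state_Suc) (auto simp: inner_vec_query quantum_network_def)
  qed
  then show ?thesis
    using assms(2) by (simp add: inner_vec_self del: of_real_sum of_real_power)
qed

end

section \<open>Distinguishability of final states\<close>

lemma sum_split_parity:
  fixes g :: "nat \<Rightarrow> real"
  shows "(\<Sum>k<n. g k) = (\<Sum>k | k < n \<and> odd k = True. g k) + (\<Sum>k | k < n \<and> odd k = False. g k)"
  by (subst sum.union_disjoint [symmetric]) (auto intro!: sum.cong)

lemma inner_vec_distinguished:
  assumes p: "dim_vec p = 2 ^ m" "(\<Sum>k<2 ^ m. (cmod (p $ k))\<^sup>2) = 1" "output_prob m p False \<ge> 2 / 3"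
    and q: "dim_vec q = 2 ^ m" "(\<Sum>k<2 ^ m. (cmod (q $ k))\<^sup>2) = 1" "output_prob m q True \<ge> 2 / 3"
  shows "cmod (inner_vec p q) \<le> 17 / 18"
proof -
  have p': "output_prob m p True + output_prob m p False = 1"
    using p(2) sum_split_parity [of "\<lambda>k. (cmod (p $ k))\<^sup>2" "2 ^ m"] by (simp add: output_prob_def)
  have q': "output_prob m q True + output_prob m q False = 1"
    using q(2) sum_split_parity [of "\<lambda>k. (cmod (q $ k))\<^sup>2" "2 ^ m"] by (simp add: output_prob_def)
  have *: "(\<Sum>k | k < 2 ^ m \<and> odd k = v. cmod (p $ k) * cmod (q $ k))
      \<le> (c * output_prob m p v + output_prob m q v / c) / 2" if "c > 0" for c v
  proof -
    have "(\<Sum>k | k < 2 ^ m \<and> odd k = v. cmod (p $ k) * cmod (q $ k))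
      \<le> (\<Sum>k | k < 2 ^ m \<and> odd k = v. (c * (cmod (p $ k))\<^sup>2 + (cmod (q $ k))\<^sup>2 / c) / 2)"
      using that by (intro sum_mono mult_le_weighted_squares)
    also have "\<dots> = (c * output_prob m p v + output_prob m q v / c) / 2"
      by (simp add: output_prob_def sum.distrib sum_distrib_left flip: sum_divide_distrib)
    finally show ?thesis .
  qed
  have "cmod (inner_vec p q) \<le> (\<Sum>k<2 ^ m. cmod (p $ k) * cmod (q $ k))"
    unfolding inner_vec_def p by (intro sum_norm_le) (simp add: norm_mult)
  also have "\<dots> = (\<Sum>k | k < 2 ^ m \<and> odd k = True. cmod (p $ k) * cmod (q $ k))
      + (\<Sum>k | k < 2 ^ m \<and> odd k = False. cmod (p $ k) * cmod (q $ k))"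
    by (rule sum_split_parity)
  \<comment> \<open>At error exactly 1/3 the best weights would be the square root of 2 and its
    inverse. The rational 3/2 and 2/3 give 2/3 + (5/12) * (1/3 + 1/3) = 17/18, still below
    1.\<close>
  also have "\<dots> \<le> (3 / 2 * output_prob m p True + output_prob m q True / (3 / 2)) / 2
      + (2 / 3 * output_prob m p False + output_prob m q False / (2 / 3)) / 2"
    by (intro add_mono *) simp_all
  also have "\<dots> \<le> 17 / 18"
  proof -
    have "output_prob m p True = 1 - output_prob m p False" "output_prob m q False = 1 - output_prob m q True"
      using p' q' by simp_all
    then show ?thesis
      using p(3) q(3) by (simp add: field_simps)
  qed
  finally show ?thesis .
qed

section \<open>The adversary argument on pairs of inputs\<close>

definition flip :: "bool list \<Rightarrow> nat \<Rightarrow> bool list" where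
  "flip X i = X[i := \<not> X ! i]"

lemma length_flip [simp]: "length (flip X i) = length X"
  by (simp add: flip_def)

lemma flip_flip: "i < length X \<Longrightarrow> flip (flip X i) i = X"
  by (simp add: flip_def)

lemma nth_flip: "j \<noteq> i \<Longrightarrow> flip X i ! j = X ! j"
  by (simp add: flip_def)

text \<open>Presents a relation as the disjoint union of its fibres, so that sums and cardinalities
  over pairs become iterated ones.\<close>

lemma Sigma_fibres:
  assumes "finite R"
  shows "R = Sigma (fst ` R) (\<lambda>x. {i. (x, i) \<in> R})" "finite {i. (x, i) \<in> R}"
proof -
  show "R = Sigma (fst ` R) (\<lambda>x. {i. (x, i) \<in> R})"
    by (auto intro: image_eqI [where f = fst, OF fst_conv [symmetric]])
  show "finite {i. (x, i) \<in> R}"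
    using finite_vimageI [OF assms, of "Pair x"] by (simp add: vimage_def inj_on_def)
qed

lemma card_fibres_le:
  assumes R: "finite R" and a: "\<And>x. x \<in> fst ` R \<Longrightarrow> a \<le> card {i. (x, i) \<in> R}"
  shows "card (fst ` R) * a \<le> card R"
proof -
  have "card R = (\<Sum>x\<in>fst ` R. card {i. (x, i) \<in> R})"
    using R by (subst Sigma_fibres(1) [OF R], subst card_SigmaI) (auto simp: Sigma_fibres(2))
  moreover have "(\<Sum>x\<in>fst ` R. a) \<le> \<dots>"
    using a by (intro sum_mono) auto
  ultimately show ?thesis
    by simp
qed

text \<open>A pair \<open>(X, i)\<close> encodes the edge from the 0-input \<open>X\<close> to the
  1-input \<open>flip X i\<close>; \<open>R'\<close> lists the same edges from the other end, and
  \<open>a\<close>, \<open>b\<close> bound the degrees from below. The index masses of one input sum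
  to at most 1, so high degrees mean that a query can affect only a small share of the
  edges.\<close>

lemma adversary_lower_bound:
  assumes network: "quantum_network N m T U" and comp: "computes_bounded_error N f m T U"
    and R: "finite R" "R \<noteq> {}"
    and rel: "\<And>X i. (X, i) \<in> R \<Longrightarrow> length X = N \<and> i < N \<and> \<not> f X \<and> f (flip X i)"
    and a: "a > 0" "\<And>X. X \<in> fst ` R \<Longrightarrow> a \<le> card {i. (X, i) \<in> R}"
  defines "R' \<equiv> (\<lambda>(X, i). (flip X i, i)) ` R"
  assumes b: "b > 0" "\<And>Y. Y \<in> fst ` R' \<Longrightarrow> b \<le> card {i. (Y, i) \<in> R'}"
  shows "sqrt (real (a * b)) / 36 \<le> real T"
proof -
  define w where "w = m - index_bits N - 1"
  define \<psi> where "\<psi> X t = network_state m U X t" for X t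
  define W where "W t = (\<Sum>(X, i)\<in>R. Re (inner_vec (\<psi> X t) (\<psi> (flip X i) t)))" for t
  \<comment> \<open>This weight balances the two costs \<open>c / a\<close> and
    \<open>1 / (b * c)\<close> of a query per edge; both become
    \<open>1 / sqrt (a * b)\<close>.\<close>
  define c where "c = sqrt (real a / real b)"
  have c: "c > 0"
    using a b by (simp add: c_def)
  have inj: "inj_on (\<lambda>(X, i). (flip X i, i)) R"
  proof (rule inj_onI, clarsimp)
    fix X Y i
    assume "(X, i) \<in> R" "(Y, i) \<in> R" "flip X i = flip Y i"
    then show "X = Y"
      using rel flip_flip by metis
  qed
  have R': "finite R'" "card R' = card R"
    using R inj by (auto simp: R'_def card_image)
  have len': "length Y = N" if "(Y, i) \<in> R'" for Y i
    using that rel by (force simp: R'_def)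
  \<comment> \<open>For a fixed input, different \<open>i\<close> select disjoint blocks of a unit
    vector, so each input contributes at most 1. The claim is stated for a general \<open>S\<close>
    because it serves both \<open>R\<close> and \<open>R'\<close>.\<close>
  have mass: "(\<Sum>(X, i)\<in>S. index_mass w i (\<psi> X t)) \<le> real (card (fst ` S))"
    if S: "finite S" "\<And>X i. (X, i) \<in> S \<Longrightarrow> length X = N" and t: "t \<le> T" for S t
  proof -
    note fin = Sigma_fibres(2) [OF S(1)]
    have "(\<Sum>(X, i)\<in>S. index_mass w i (\<psi> X t))
        = (\<Sum>X\<in>fst ` S. \<Sum>i | (X, i) \<in> S. index_mass w i (\<psi> X t))"
      using S(1) fin by (subst Sigma_fibres(1) [OF S(1)], subst sum.Sigma) auto
    also have "\<dots> \<le> (\<Sum>X\<in>fst ` S. 1)"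
    proof (intro sum_mono)
      fix X
      assume "X \<in> fst ` S"
      then have "length X = N"
        using S(2) by force
      then show "(\<Sum>i | (X, i) \<in> S. index_mass w i (\<psi> X t)) \<le> 1"
        using sum_index_mass_le [OF fin [of X], of w "\<psi> X t"] t
          network_state_norm [OF network, of X t] dim_network_state [OF network, of t X]
        by (simp add: \<psi>_def)
    qed
    finally show ?thesis
      by simp
  qed
  have step: "W t - W (Suc t) \<le> real (card R) * (2 / sqrt (real (a * b)))" if t: "Suc t \<le> T" for t
  proof -
    have "W t - W (Suc t) = (\<Sum>(X, i)\<in>R. Re (inner_vec (\<psi> X t) (\<psi> (flip X i) t))
        - Re (inner_vec (\<psi> X (Suc t)) (\<psi> (flip X i) (Suc t))))"
      unfolding W_def by (simp add: sum_subtractf case_prod_unfold)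
    also have "\<dots> \<le> (\<Sum>(X, i)\<in>R. c * index_mass w i (\<psi> X t) + index_mass w i (\<psi> (flip X i) t) / c)"
    proof (intro sum_mono, clarify)
      fix X i
      assume "(X, i) \<in> R"
      then have "length X = N"
        using rel by blast
      then have "cmod (inner_vec (\<psi> X (Suc t)) (\<psi> (flip X i) (Suc t)) - inner_vec (\<psi> X t) (\<psi> (flip X i) t))
          \<le> c * index_mass w i (\<psi> X t) + index_mass w i (\<psi> (flip X i) t) / c"
        unfolding \<psi>_def w_def inner_vec_network_state_Suc [OF network t]
        using network t c
        by (intro inner_vec_query_diff) (auto simp: quantum_network_def nth_flip dim_network_state [OF network])
      then show "Re (inner_vec (\<psi> X t) (\<psi> (flip X i) t))
          - Re (inner_vec (\<psi> X (Suc t)) (\<psi> (flip X i) (Suc t)))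
          \<le> c * index_mass w i (\<psi> X t) + index_mass w i (\<psi> (flip X i) t) / c"
        using abs_Re_le_cmod [of "inner_vec (\<psi> X (Suc t)) (\<psi> (flip X i) (Suc t)) - inner_vec (\<psi> X t) (\<psi> (flip X i) t)"]
        by simp
    qed
    also have "\<dots> = c * (\<Sum>(X, i)\<in>R. index_mass w i (\<psi> X t)) + (\<Sum>(X, i)\<in>R'. index_mass w i (\<psi> X t)) / c"
      unfolding R'_def sum.reindex [OF inj]
      by (simp add: case_prod_unfold sum.distrib sum_distrib_left sum_divide_distrib)
    also have "\<dots> \<le> c * real (card (fst ` R)) + real (card (fst ` R')) / c"
      using c R rel R' len' t by (intro add_mono mult_left_mono divide_right_mono mass) auto
    also have "\<dots> \<le> c * (real (card R) / real a) + (real (card R) / real b) / c"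
    proof (intro add_mono mult_left_mono divide_right_mono)
      show "real (card (fst ` R)) \<le> real (card R) / real a"
        using card_fibres_le [OF R(1) a(2)] a(1)
        by (simp add: pos_le_divide_eq flip: of_nat_mult)
      show "real (card (fst ` R')) \<le> real (card R) / real b"
        using card_fibres_le [OF R'(1) b(2)] b(1) R'(2)
        by (simp add: pos_le_divide_eq flip: of_nat_mult)
    qed (use c in auto)
    also have "\<dots> = real (card R) * (2 / sqrt (real (a * b)))"
      using a(1) b(1) by (simp add: c_def real_sqrt_divide real_sqrt_mult field_simps)
    finally show ?thesis .
  qed
  have decay: "W 0 - W t \<le> real t * (real (card R) * (2 / sqrt (real (a * b))))" if "t \<le> T" for t
    using that
  proof (induction t)
    case (Suc t)
    then show ?case
      using step [of t] by (simp add: algebra_simps add_divide_distrib)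
  qed simp
  have W0: "W 0 = real (card R)"
    unfolding W_def \<psi>_def inner_vec_network_state_0 [OF network] by simp
  have "W T \<le> (\<Sum>(X, i)\<in>R. 17 / 18)"
    unfolding W_def
  proof (intro sum_mono, clarify)
    fix X i
    assume Xi: "(X, i) \<in> R"
    have "cmod (inner_vec (\<psi> X T) (\<psi> (flip X i) T)) \<le> 17 / 18"
      unfolding \<psi>_def
    proof (rule inner_vec_distinguished)
      show "output_prob m (network_state m U X T) False \<ge> 2 / 3"
        using comp rel [OF Xi] unfolding computes_bounded_error_def by metis
      show "output_prob m (network_state m U (flip X i) T) True \<ge> 2 / 3"
        using comp rel [OF Xi] length_flip unfolding computes_bounded_error_def by metis
    qed (use rel [OF Xi] network_state_norm [OF network] dim_network_state [OF network] in auto)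
    then show "Re (inner_vec (\<psi> X T) (\<psi> (flip X i) T)) \<le> 17 / 18"
      using complex_Re_le_cmod order_trans by blast
  qed
  then have "W T \<le> real (card R) * (17 / 18)"
    by (simp add: case_prod_unfold)
  \<comment> \<open>The fraction 1/18 = 1 - 17/18 has to be lost in the course of \<open>T\<close>
    queries; together with the factor 2 in the loss per query it yields the 36.\<close>
  then have "real (card R) * (1 / 18) \<le> real T * (real (card R) * (2 / sqrt (real (a * b))))"
    using decay [of T] W0 by linarith
  then have "real (card R) * (1 / 18) \<le> real (card R) * (real T * (2 / sqrt (real (a * b))))"
    by (simp only: mult.left_commute)
  moreover have "real (card R) > 0"
    using R by (simp add: card_gt_0_iff)
  ultimately have "1 / 18 \<le> real T * (2 / sqrt (real (a * b)))"
    by (simp only: mult_le_cancel_left_pos)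
  then show ?thesis
    using a(1) b(1) by (simp add: field_simps)
qed

section \<open>The lower bound for threshold functions\<close>

lemma count_list_True: "count_list X True = card {i. i < length X \<and> X ! i}"
  by (simp add: count_list_eq_length_filter length_filter_conv_card)

lemma count_list_flip:
  assumes "i < length X" "\<not> X ! i"
  shows "count_list (flip X i) True = Suc (count_list X True)"
proof -
  have "{j. j < length (flip X i) \<and> flip X i ! j} = insert i {j. j < length X \<and> X ! j}"
    using assms by (auto simp: flip_def nth_list_update)
  then show ?thesis
    using assms by (simp add: count_list_True)
qed

text \<open>The degrees of the relation: an input of weight \<open>M - 1\<close> has
  \<open>N - (M - 1)\<close> zeros to flip up, an input of weight \<open>M\<close> has
  \<open>M\<close> ones to flip down.\<close>

lemma threshold_lower_bound:
  assumes "quantum_network N m T U" "computes_bounded_error N (THRESHOLD M) m T U"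
    and M: "1 \<le> M" "M \<le> N"
  shows "sqrt (real ((N - (M - 1)) * M)) / 36 \<le> real T"
proof -
  define R where "R = {(X, i). length X = N \<and> count_list X True = M - 1 \<and> i < N \<and> \<not> X ! i}"
  define R' where "R' = (\<lambda>(X, i). (flip X i, i)) ` R"
  have R'I: "(Y, i) \<in> R'" if "length Y = N" "count_list Y True = M" "i < N" "Y ! i" for Y i
  proof -
    have "flip (flip Y i) i = Y" "\<not> flip Y i ! i"
      using that by (auto simp: flip_flip) (simp add: flip_def)
    moreover from this have "count_list Y True = Suc (count_list (flip Y i) True)"
      using count_list_flip [of i "flip Y i"] that by simp
    ultimately have "(flip Y i, i) \<in> R"
      using that by (simp add: R_def)
    then show ?thesis
      unfolding R'_def using \<open>flip (flip Y i) i = Y\<close> by force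
  qed
  have R'D: "length Y = N \<and> count_list Y True = M" if "(Y, i) \<in> R'" for Y i
    using that M count_list_flip by (auto simp: R'_def R_def)
  show ?thesis
  proof (rule adversary_lower_bound [OF assms(1,2), of R])
    have "R \<subseteq> {X. set X \<subseteq> UNIV \<and> length X = N} \<times> {..<N}"
      by (auto simp: R_def)
    then show "finite R"
      by (rule finite_subset) (intro finite_cartesian_product finite_lists_length_eq, auto)
    \<comment> \<open>Ones first, then zeros: since \<open>M \<le> N\<close>, the last position
      holds a zero.\<close>
    define X where "X = replicate (M - 1) True @ replicate (N - (M - 1)) False"
    have "(X, N - 1) \<in> R"
      using M by (auto simp: R_def X_def nth_append count_list_eq_length_filter filter_replicate)
    then show "R \<noteq> {}"
      by blast
  next
    fix X i
    assume "(X, i) \<in> R"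
    then show "length X = N \<and> i < N \<and> \<not> THRESHOLD M X \<and> THRESHOLD M (flip X i)"
      using M by (auto simp: R_def THRESHOLD_def count_list_flip)
  next
    fix X
    assume "X \<in> fst ` R"
    then have X: "length X = N" "count_list X True = M - 1"
      by (auto simp: R_def)
    have "{i. (X, i) \<in> R} = {..<N} - {i. i < length X \<and> X ! i}"
      using X by (auto simp: R_def)
    then show "N - (M - 1) \<le> card {i. (X, i) \<in> R}"
      using X by (simp add: card_Diff_subset count_list_True subset_iff)
  next
    fix Y
    assume "Y \<in> fst ` (\<lambda>(X, i). (flip X i, i)) ` R"
    then have Y: "length Y = N" "count_list Y True = M"
      using R'D unfolding R'_def by force+
    have "{i. (Y, i) \<in> R'} \<subseteq> {..<N}"
      by (auto simp: R'_def R_def)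
    then have fin: "finite {i. (Y, i) \<in> R'}"
      by (rule finite_subset) simp
    have "card {i. i < length Y \<and> Y ! i} \<le> card {i. (Y, i) \<in> R'}"
      using Y R'I by (intro card_mono fin) auto
    then show "M \<le> card {i. (Y, i) \<in> (\<lambda>(X, i). (flip X i, i)) ` R}"
      using Y unfolding R'_def count_list_True by simp
  qed (use M in auto)
qed

section \<open>Networks from real phase-query algorithms\<close>

lemma sum_delta_mult:
  fixes f :: "'a \<Rightarrow> real"
  assumes "finite S" "x \<in> S"
  shows "(\<Sum>k\<in>S. (if x = k then 1 else 0) * f k) = f x"
    and "(\<Sum>k\<in>S. f k * (if k = x then 1 else 0)) = f x"
  using assms by (simp_all add: if_distrib [of "\<lambda>x. x * _"] if_distrib [of "\<lambda>x. _ * x"] cong: if_cong)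

text \<open>A real symmetric matrix is its own adjoint, so both unitarity equations say that it
  squares to the identity.\<close>

lemma unitary_mat_of_real_involution:
  fixes S :: "nat \<Rightarrow> nat \<Rightarrow> real"
  assumes sym: "\<And>r c. S r c = S c r"
    and inv: "\<And>r c. r < d \<Longrightarrow> c < d \<Longrightarrow> (\<Sum>k<d. S r k * S k c) = (if r = c then 1 else 0)"
  shows "unitary_mat d (mat d d (\<lambda>(r, c). complex_of_real (S r c)))" (is "unitary_mat d ?U")
proof -
  have adj: "mat_adjoint ?U = ?U"
    by (rule eq_matI) (simp_all add: mat_adjoint_def mat_of_rows_def sym)
  have "?U * ?U = 1\<^sub>m d"
  proof (rule eq_matI)
    fix r c
    assume "r < dim_row (1\<^sub>m d)" "c < dim_col (1\<^sub>m d)"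
    then have rc: "r < d" "c < d"
      by simp_all
    then have "(?U * ?U) $$ (r, c) = complex_of_real (\<Sum>k<d. S r k * S k c)"
      by (simp add: scalar_prod_def lessThan_atLeast0)
    then show "(?U * ?U) $$ (r, c) = 1\<^sub>m d $$ (r, c)"
      using rc inv by simp
  qed simp_all
  then show ?thesis
    unfolding unitary_mat_def adj by simp
qed

text \<open>The unitary is \<open>1 - \<Sum>\<^sub>j u\<^sub>j u\<^sub>j\<^sup>T\<close> with \<open>u\<^sub>j = a\<^sub>j - b\<^sub>j\<close>, a product of commuting
  Householder reflections; this is why the two systems have to be orthogonal to each other.\<close>

lemma exists_unitary_swap:
  fixes a b :: "'j \<Rightarrow> nat \<Rightarrow> real"
  assumes J: "finite J"
    and aa: "\<And>i j. i \<in> J \<Longrightarrow> j \<in> J \<Longrightarrow> (\<Sum>k<d. a i k * a j k) = (if i = j then 1 else 0)"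
    and bb: "\<And>i j. i \<in> J \<Longrightarrow> j \<in> J \<Longrightarrow> (\<Sum>k<d. b i k * b j k) = (if i = j then 1 else 0)"
    and ab: "\<And>i j. i \<in> J \<Longrightarrow> j \<in> J \<Longrightarrow> (\<Sum>k<d. a i k * b j k) = 0"
  shows "\<exists>U. unitary_mat d U \<and> (\<forall>\<phi>.
    U *\<^sub>v vec d (\<lambda>k. complex_of_real (\<Sum>j\<in>J. \<phi> j * a j k)) = vec d (\<lambda>k. complex_of_real (\<Sum>j\<in>J. \<phi> j * b j k)))"
proof -
  define u where "u j k = a j k - b j k" for j k
  define P where "P r c = (\<Sum>j\<in>J. u j r * u j c)" for r c
  define S where "S r c = (if r = c then 1 else 0) - P r c" for r c
  have ba: "(\<Sum>k<d. b i k * a j k) = 0" if "i \<in> J" "j \<in> J" for i j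
    using ab [OF that(2,1)] by (simp add: mult.commute)
  \<comment> \<open>Each \<open>u i\<close> has squared length 2, which is why the reflection is
    \<open>1 - u u^T\<close> without a normalising factor.\<close>
  have uu: "(\<Sum>k<d. u i k * u j k) = 2 * (if j = i then 1 else 0)" if "i \<in> J" "j \<in> J" for i j
    unfolding u_def using aa bb ab ba that by (auto simp: algebra_simps sum.distrib sum_subtractf)
  have ua: "(\<Sum>k<d. u i k * a j k) = (if i = j then 1 else 0)" if "i \<in> J" "j \<in> J" for i j
    unfolding u_def using aa ba that by (simp add: algebra_simps sum_subtractf)
  \<comment> \<open>\<open>P\<close> is twice a projection, hence
    \<open>(1 - P)^2 = 1 - 2 P + 2 P = 1\<close>.\<close>
  have PP: "(\<Sum>k<d. P r k * P k c) = 2 * P r c" for r c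
  proof -
    have "(\<Sum>k<d. P r k * P k c) = (\<Sum>k<d. \<Sum>i\<in>J. \<Sum>j\<in>J. u i r * u j c * (u i k * u j k))"
      unfolding P_def sum_product by (simp add: mult_ac)
    also have "\<dots> = (\<Sum>i\<in>J. \<Sum>j\<in>J. u i r * u j c * (\<Sum>k<d. u i k * u j k))"
      unfolding sum_distrib_left by (rule trans [OF sum.swap sum.cong [OF refl sum.swap]])
    also have "\<dots> = (\<Sum>i\<in>J. \<Sum>j\<in>J. u i r * u j c * 2 * (if j = i then 1 else 0))"
      by (intro sum.cong refl) (simp add: uu)
    also have "\<dots> = (\<Sum>i\<in>J. u i r * u i c * 2)"
      using J by (intro sum.cong refl) (simp add: sum_delta_mult)
    finally show ?thesis
      by (simp add: P_def sum_distrib_left mult_ac)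
  qed
  define U where "U = mat d d (\<lambda>(r, c). complex_of_real (S r c))"
  have "unitary_mat d U"
    unfolding U_def
  proof (rule unitary_mat_of_real_involution)
    show "S r c = S c r" for r c
      by (simp add: S_def P_def mult.commute)
    show "(\<Sum>k<d. S r k * S k c) = (if r = c then 1 else 0)" if "r < d" "c < d" for r c
    proof -
      have "(\<Sum>k<d. S r k * S k c) = (\<Sum>k<d. (if r = k then 1 else 0) * (if k = c then 1 else 0))
          - (\<Sum>k<d. (if r = k then 1 else 0) * P k c) - (\<Sum>k<d. P r k * (if k = c then 1 else 0))
          + (\<Sum>k<d. P r k * P k c)"
        unfolding S_def by (simp only: left_diff_distrib right_diff_distrib sum_subtractf)
      then show ?thesis
        using that by (simp add: sum_delta_mult PP)
    qed
  qed
  moreover have "U *\<^sub>v vec d (\<lambda>k. complex_of_real (\<Sum>j\<in>J. \<phi> j * a j k))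
      = vec d (\<lambda>k. complex_of_real (\<Sum>j\<in>J. \<phi> j * b j k))" for \<phi>
  proof (rule eq_vecI)
    fix r
    assume "r < dim_vec (vec d (\<lambda>k. complex_of_real (\<Sum>j\<in>J. \<phi> j * b j k)))"
    then have r: "r < d"
      by simp
    \<comment> \<open>As the \<open>u i\<close> are dual to the \<open>a j\<close>, \<open>P\<close>
      turns a combination of the \<open>a j\<close> into the same combination of the
      \<open>u j\<close>; subtracting it leaves that of the \<open>b j\<close>.\<close>
    have "(\<Sum>c<d. P r c * (\<Sum>j\<in>J. \<phi> j * a j c)) = (\<Sum>c<d. \<Sum>i\<in>J. \<Sum>j\<in>J. u i r * \<phi> j * (u i c * a j c))"
      unfolding P_def sum_product by (simp add: mult_ac)
    also have "\<dots> = (\<Sum>i\<in>J. \<Sum>j\<in>J. u i r * \<phi> j * (\<Sum>c<d. u i c * a j c))"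
      unfolding sum_distrib_left by (rule trans [OF sum.swap sum.cong [OF refl sum.swap]])
    also have "\<dots> = (\<Sum>i\<in>J. \<Sum>j\<in>J. u i r * ((if i = j then 1 else 0) * \<phi> j))"
      by (intro sum.cong refl) (simp add: ua)
    also have "\<dots> = (\<Sum>i\<in>J. u i r * \<phi> i)"
      using J by (simp add: sum_delta_mult flip: sum_distrib_left)
    finally have *: "(\<Sum>c<d. P r c * (\<Sum>j\<in>J. \<phi> j * a j c)) = (\<Sum>i\<in>J. u i r * \<phi> i)" .
    have "(U *\<^sub>v vec d (\<lambda>k. complex_of_real (\<Sum>j\<in>J. \<phi> j * a j k))) $ r
        = complex_of_real (\<Sum>c<d. S r c * (\<Sum>j\<in>J. \<phi> j * a j c))"
      using r by (simp add: U_def scalar_prod_def lessThan_atLeast0)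
    also have "(\<Sum>c<d. S r c * (\<Sum>j\<in>J. \<phi> j * a j c)) = (\<Sum>j\<in>J. \<phi> j * a j r) - (\<Sum>i\<in>J. u i r * \<phi> i)"
      unfolding S_def * [symmetric] left_diff_distrib sum_subtractf using r by (simp add: sum_delta_mult)
    also have "\<dots> = (\<Sum>j\<in>J. \<phi> j * b j r)"
      by (simp add: u_def algebra_simps flip: sum_subtractf)
    finally show "(U *\<^sub>v vec d (\<lambda>k. complex_of_real (\<Sum>j\<in>J. \<phi> j * a j k))) $ r
        = vec d (\<lambda>k. complex_of_real (\<Sum>j\<in>J. \<phi> j * b j k)) $ r"
      using r by simp
  qed (simp add: U_def)
  ultimately show ?thesis
    by blast
qed

text \<open>In phase form a query only changes signs, so real amplitudes suffice. The switch
  \<open>act\<close> lets some branches pause while others go on querying.\<close>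

definition phase :: "('j \<Rightarrow> nat) \<Rightarrow> (nat \<Rightarrow> 'j \<Rightarrow> bool) \<Rightarrow> bool list \<Rightarrow> nat \<Rightarrow> 'j \<Rightarrow> real" where
  "phase l act X r j = (if act r j \<and> X ! l j then -1 else 1)"

fun phase_state where
  "phase_state J l act V \<phi> X 0 j = \<phi> j"
| "phase_state J l act V \<phi> X (Suc r) j =
    (\<Sum>i\<in>J. V r j i * (phase l act X r i * phase_state J l act V \<phi> X r i))"

text \<open>At time \<open>r\<close>, the abstract basis state \<open>j\<close> is realised as \<open>|l j, \<plusminus>, z r j\<rangle>\<close>, where the sign is
  \<open>-\<close> if the next query is to act on \<open>j\<close>, so that \<open>X ! l j\<close> turns into a phase, and \<open>+\<close> if it is
  to have no effect. The tag \<open>r\<close> in \<open>z\<close> makes the realisations at different times orthogonal, as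
  \<open>exists_unitary_swap\<close> requires, and the last bit of \<open>z\<close> is the output.\<close>

lemma phase_algorithm_network:
  fixes J :: "'j set" and V :: "nat \<Rightarrow> 'j \<Rightarrow> 'j \<Rightarrow> real"
  assumes J: "finite J" and l: "\<And>j. j \<in> J \<Longrightarrow> l j < N"
    and \<phi>: "(\<Sum>j\<in>J. (\<phi> j)\<^sup>2) = 1"
    and V: "\<And>r i j. r < T \<Longrightarrow> i \<in> J \<Longrightarrow> j \<in> J \<Longrightarrow> (\<Sum>k\<in>J. V r k i * V r k j) = (if i = j then 1 else 0)"
  shows "\<exists>m U. quantum_network N m T U \<and> (\<forall>X v. length X = N \<longrightarrow>
    output_prob m (network_state m U X T) v = (\<Sum>j | j \<in> J \<and> acc j = v. (phase_state J l act V \<phi> X T j)\<^sup>2))"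
proof -
  define d where "d = card J"
  obtain enc where "bij_betw enc J {..<d}"
    using ex_bij_betw_finite_nat [OF J] unfolding d_def lessThan_atLeast0 by blast
  then have enc: "inj_on enc J" "\<And>j. j \<in> J \<Longrightarrow> enc j < d"
    by (auto simp: bij_betw_def)
  \<comment> \<open>The pair of time and state is encoded as a number with remainder below
    \<open>d\<close>. The \<open>+ 1\<close> keeps \<open>z\<close> nonzero, so that no realised
    state is the initial state 0; doubling frees the last bit for the output.\<close>
  define z where "z r j = 2 * (r * d + enc j + 1) + of_bool (acc j)" for r j
  \<comment> \<open>A generous choice: \<open>w\<close> exceeds every \<open>z r j\<close> itself,
    and \<open>w < 2 ^ w\<close>. It is positive, so the parity of a basis number is that of its
    \<open>z\<close>.\<close>
  define w where "w = 2 * (Suc T * d + 1) + 1"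
  define m where "m = index_bits N + w + 1"
  define D :: nat where "D = 2 ^ m"
  have z_less: "z r j < 2 ^ w" if "r \<le> T" "j \<in> J" for r j
  proof -
    have "r * d + enc j < Suc r * d"
      using enc(2) [OF that(2)] by simp
    also have "\<dots> \<le> Suc T * d"
      using that(1) by (intro mult_le_mono1) simp
    finally have "z r j < w"
      unfolding z_def w_def by (cases "acc j") auto
    also have "w < 2 ^ w"
      by (rule less_exp)
    finally show ?thesis .
  qed
  have z_inject: "r = r' \<and> i = j" if "z r i = z r' j" "i \<in> J" "j \<in> J" for r r' i j
  proof -
    have "r * d + enc i = r' * d + enc j"
      using that(1) unfolding z_def by (cases "acc i"; cases "acc j"; simp; presburger)
    moreover have "(r * d + enc i) div d = r" "(r * d + enc i) mod d = enc i"
        "(r' * d + enc j) div d = r'" "(r' * d + enc j) mod d = enc j"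
      using enc(2) [OF that(2)] enc(2) [OF that(3)] by auto
    ultimately have "r = r'" "enc i = enc j"
      by metis+
    with enc(1) that show ?thesis
      by (auto dest: inj_onD)
  qed
  define e where "e b r j = basis_num w (l j) b (z r j)" for b r j
  have e_less: "e b r j < D" if "r \<le> T" "j \<in> J" for b r j
  proof -
    have "e b r j div 2 ^ (w + 1) < 2 ^ index_bits N"
      unfolding e_def basis_num_div [OF z_less [OF that]]
      using l [OF that(2)] le_two_power_index_bits [of N] by linarith
    then have "e b r j < 2 ^ index_bits N * 2 ^ (w + 1)"
      by (subst (asm) div_less_iff_less_mult) simp_all
    then show ?thesis
      unfolding D_def m_def by (simp only: power_add [symmetric] add.assoc)
  qed
  have e_inject: "e b r i = e b' r' j \<longleftrightarrow> b = b' \<and> r = r' \<and> i = j"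
    if "r \<le> T" "r' \<le> T" "i \<in> J" "j \<in> J" for b b' r r' i j
  proof
    assume "e b r i = e b' r' j"
    then have "b = b'" "z r i = z r' j"
      using basis_num_inject [OF z_less z_less] that unfolding e_def by metis+
    then show "b = b' \<and> r = r' \<and> i = j"
      using z_inject [OF _ that(3,4)] by simp
  qed simp
  have e_query: "query_basis w X (e b r j) = (if X ! l j then e (\<not> b) r j else e b r j)"
    if "r \<le> T" "j \<in> J" "length X = N" for X b r j
    unfolding e_def query_basis_basis_num [OF z_less [OF that(1,2)]] using l [OF that(2)] that(3) by simp
  have e_odd: "odd (e b r j) = acc j" for b r j
    unfolding e_def basis_num_def z_def by (cases "acc j") (simp_all add: w_def)
  have e_pos: "e b r j \<noteq> 0" for b r j
    unfolding e_def basis_num_def z_def by simp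
  define sg :: "nat \<Rightarrow> 'j \<Rightarrow> real" where "sg r j = (if act r j then -1 else 1)" for r j
  define a :: "nat \<Rightarrow> 'j \<Rightarrow> nat \<Rightarrow> real" where
    "a r j k = (if k = e False r j then 1 / sqrt 2 else if k = e True r j then sg r j / sqrt 2 else 0)" for r j k
  have a_support: "k = e False r j \<or> k = e True r j" if "a r j k \<noteq> 0" for r j k
    using that by (auto simp: a_def split: if_splits)
  have a_ortho: "(\<Sum>k<D. a r i k * a r' j k) = (if r = r' \<and> i = j then 1 else 0)"
    if "r \<le> T" "r' \<le> T" "i \<in> J" "j \<in> J" for r r' i j
  proof (cases "r = r' \<and> i = j")
    case True
    have "(\<Sum>k<D. a r i k * a r i k) = (\<Sum>k\<in>{e False r i, e True r i}. a r i k * a r i k)"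
      using that by (intro sum.mono_neutral_right) (auto simp: e_less dest: a_support)
    also have "\<dots> = 1"
      using e_inject that by (simp add: a_def sg_def)
    finally show ?thesis
      using True by simp
  next
    case False
    then have "a r i k * a r' j k = 0" for k
      using a_support e_inject that by (metis mult_eq_0_iff)
    then show ?thesis
      using False by simp
  qed
  \<comment> \<open>Phase kickback: flipping the target bit exchanges the two entries of
    \<open>a r j\<close>, which negates a minus state and fixes a plus state.\<close>
  have a_query: "a r j (query_basis w X k) = phase l act X r j * a r j k"
    if "r \<le> T" "j \<in> J" "length X = N" for r j X k
  proof -
    have "query_basis w X k = e b r j \<longleftrightarrow> k = (if X ! l j then e (\<not> b) r j else e b r j)" for b
      using e_query [OF that] query_basis_involution by metis
    moreover have "e False r j \<noteq> e True r j"
      using e_inject that by simp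
    ultimately show ?thesis
      by (auto simp: a_def sg_def phase_def)
  qed
  define emb where "emb r \<psi> = vec D (\<lambda>k. complex_of_real (\<Sum>j\<in>J. \<psi> j * a r j k))" for r and \<psi> :: "'j \<Rightarrow> real"
  have emb_query: "query_mat m X *\<^sub>v emb r \<psi> = emb r (\<lambda>j. phase l act X r j * \<psi> j)"
    if "r \<le> T" "length X = N" for X r \<psi>
  proof (rule eq_vecI)
    fix k
    assume "k < dim_vec (emb r (\<lambda>j. phase l act X r j * \<psi> j))"
    then have k: "k < D"
      by (simp add: emb_def)
    have "query_basis w X k < D"
      using k unfolding D_def by (intro query_basis_less) (simp add: m_def)
    moreover have "(query_mat m X *\<^sub>v emb r \<psi>) $ k = emb r \<psi> $ query_basis w X k"
      using k that by (subst query_mat_mult_vec) (simp_all add: emb_def D_def m_def)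
    ultimately show "(query_mat m X *\<^sub>v emb r \<psi>) $ k = emb r (\<lambda>j. phase l act X r j * \<psi> j) $ k"
      using k that by (simp add: emb_def a_query mult_ac)
  qed (simp add: emb_def D_def)
  \<comment> \<open>In other words, the embedding at a fixed time is isometric.\<close>
  have ortho_comb: "(\<Sum>k<D. (\<Sum>i\<in>J. f i * a r i k) * (\<Sum>j\<in>J. g j * a r j k)) = (\<Sum>i\<in>J. f i * g i)"
    if "r \<le> T" for r f g
  proof -
    have "(\<Sum>k<D. (\<Sum>i\<in>J. f i * a r i k) * (\<Sum>j\<in>J. g j * a r j k))
        = (\<Sum>k<D. \<Sum>i\<in>J. \<Sum>j\<in>J. f i * g j * (a r i k * a r j k))"
      unfolding sum_product by (simp add: mult_ac)
    also have "\<dots> = (\<Sum>i\<in>J. \<Sum>j\<in>J. f i * g j * (\<Sum>k<D. a r i k * a r j k))"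
      unfolding sum_distrib_left by (rule trans [OF sum.swap sum.cong [OF refl sum.swap]])
    also have "\<dots> = (\<Sum>i\<in>J. \<Sum>j\<in>J. f i * ((if i = j then 1 else 0) * g j))"
      using that by (intro sum.cong refl) (simp add: a_ortho)
    also have "\<dots> = (\<Sum>i\<in>J. f i * g i)"
      using J by (simp add: sum_delta_mult flip: sum_distrib_left)
    finally show ?thesis .
  qed
  have "\<exists>U. unitary_mat D U \<and> (\<forall>\<psi>. U *\<^sub>v emb r \<psi> = emb (Suc r) (\<lambda>j. \<Sum>i\<in>J. V r j i * \<psi> i))" if r: "r < T" for r
  proof -
    \<comment> \<open>\<open>b i\<close> is the image of state \<open>i\<close> under
      \<open>V r\<close>, realised at time \<open>Suc r\<close>. It is orthogonal to all states
      realised at time \<open>r\<close> because the time tags differ.\<close>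
    define b where "b i k = (\<Sum>j\<in>J. V r j i * a (Suc r) j k)" for i k
    have "\<exists>U. unitary_mat D U \<and> (\<forall>\<psi>.
      U *\<^sub>v vec D (\<lambda>k. complex_of_real (\<Sum>j\<in>J. \<psi> j * a r j k)) = vec D (\<lambda>k. complex_of_real (\<Sum>j\<in>J. \<psi> j * b j k)))"
    proof (rule exists_unitary_swap [OF J])
      show "(\<Sum>k<D. b i k * b j k) = (if i = j then 1 else 0)" if "i \<in> J" "j \<in> J" for i j
        unfolding b_def using r that by (simp add: ortho_comb V)
      show "(\<Sum>k<D. a r i k * b j k) = 0" if "i \<in> J" "j \<in> J" for i j
      proof -
        have "(\<Sum>k<D. a r i k * b j k) = (\<Sum>k<D. \<Sum>s\<in>J. V r s j * (a r i k * a (Suc r) s k))"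
          by (simp add: b_def sum_distrib_left mult_ac)
        also have "\<dots> = (\<Sum>s\<in>J. V r s j * (\<Sum>k<D. a r i k * a (Suc r) s k))"
          unfolding sum_distrib_left by (rule sum.swap)
        also have "\<dots> = 0"
          using r that by (simp add: a_ortho)
        finally show ?thesis .
      qed
    qed (use r in \<open>simp add: a_ortho\<close>)
    moreover have "(\<Sum>j\<in>J. \<psi> j * b j k) = (\<Sum>j\<in>J. (\<Sum>i\<in>J. V r j i * \<psi> i) * a (Suc r) j k)" for \<psi> k
      unfolding b_def sum_distrib_left sum_distrib_right by (subst sum.swap) (simp add: mult_ac)
    ultimately show ?thesis
      unfolding emb_def by simp
  qed
  then have "\<forall>r\<in>{..<T}. \<exists>U. unitary_mat D U \<and> (\<forall>\<psi>. U *\<^sub>v emb r \<psi> = emb (Suc r) (\<lambda>j. \<Sum>i\<in>J. V r j i * \<psi> i))"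
    by simp
  from bchoice [OF this] obtain Vmat where Vmat: "\<And>r. r < T \<Longrightarrow> unitary_mat D (Vmat r)"
      "\<And>r \<psi>. r < T \<Longrightarrow> Vmat r *\<^sub>v emb r \<psi> = emb (Suc r) (\<lambda>j. \<Sum>i\<in>J. V r j i * \<psi> i)"
    by auto
  \<comment> \<open>The first unitary is a swap of families with one member, indexed by
    \<open>()\<close>: it exchanges the basis state 0 with the realisation of
    \<open>\<phi>\<close>.\<close>
  have "\<exists>U. unitary_mat D U \<and> (\<forall>\<psi>.
      U *\<^sub>v vec D (\<lambda>k. complex_of_real (\<Sum>j\<in>{()}. \<psi> j * (if k = 0 then 1 else 0)))
        = vec D (\<lambda>k. complex_of_real (\<Sum>j\<in>{()}. \<psi> j * (\<Sum>j\<in>J. \<phi> j * a 0 j k))))"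
  proof (rule exists_unitary_swap)
    show "(\<Sum>k<D. (if k = 0 then 1 else 0) * (if k = 0 then 1 else 0)) = (if i = j then 1 else (0::real))" for i j :: unit
      by (simp add: D_def if_distrib [of "\<lambda>x. x * _"] cong: if_cong)
    show "(\<Sum>k<D. (\<Sum>j\<in>J. \<phi> j * a 0 j k) * (\<Sum>j\<in>J. \<phi> j * a 0 j k)) = (if i = j then 1 else 0)" for i j :: unit
      using \<phi> by (simp add: ortho_comb power2_eq_square)
    have "a 0 j 0 = 0" for j
      using a_support [of 0 j 0] e_pos by metis
    then show "(\<Sum>k<D. (if k = 0 then 1 else 0) * (\<Sum>j\<in>J. \<phi> j * a 0 j k)) = 0"
      by (simp add: if_distrib [of "\<lambda>x. x * _"] cong: if_cong)
  qed simp
  then obtain U0 where U0: "unitary_mat D U0"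
      "\<And>\<psi> :: unit \<Rightarrow> real. U0 *\<^sub>v vec D (\<lambda>k. complex_of_real (\<Sum>j\<in>{()}. \<psi> j * (if k = 0 then 1 else 0)))
        = vec D (\<lambda>k. complex_of_real (\<Sum>j\<in>{()}. \<psi> j * (\<Sum>j\<in>J. \<phi> j * a 0 j k)))"
    by blast
  have "vec D (\<lambda>k. complex_of_real (\<Sum>j\<in>{()}. 1 * (if k = 0 then 1 else 0))) = unit_vec D 0"
    by (rule eq_vecI) (auto simp: unit_vec_def)
  with U0(2) [of "\<lambda>_. 1"] have init: "U0 *\<^sub>v unit_vec D 0 = emb 0 \<phi>"
    by (simp add: emb_def)
  define U where "U r = (case r of 0 \<Rightarrow> U0 | Suc r \<Rightarrow> Vmat r)" for r
  have "quantum_network N m T U"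
    unfolding quantum_network_def
  proof (intro conjI allI impI)
    show "unitary_mat (2 ^ m) (U j)" if "j \<le> T" for j
      using U0(1) Vmat(1) that unfolding D_def U_def by (cases j) auto
  qed (simp add: m_def)
  moreover have state: "network_state m U X r = emb r (phase_state J l act V \<phi> X r)" if "length X = N" "r \<le> T" for X r
    using that(2)
  proof (induction r)
    case 0
    have "phase_state J l act V \<phi> X 0 = \<phi>"
      by (rule ext) simp
    then show ?case
      using init by (simp add: U_def D_def)
  next
    case (Suc r)
    have "phase_state J l act V \<phi> X (Suc r)
        = (\<lambda>j. \<Sum>i\<in>J. V r j i * (phase l act X r i * phase_state J l act V \<phi> X r i))"
      by (rule ext) simp
    with Suc that(1) show ?case
      by (simp add: emb_query U_def Vmat(2))
  qed
  moreover have "output_prob m (emb T \<psi>) v = (\<Sum>j | j \<in> J \<and> acc j = v. (\<psi> j)\<^sup>2)" for \<psi> v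
  proof -
    have "output_prob m (emb T \<psi>) v = (\<Sum>k | k < D \<and> odd k = v. (\<Sum>j\<in>J. \<psi> j * a T j k)\<^sup>2)"
      unfolding output_prob_def D_def [symmetric] emb_def by (intro sum.cong) (auto simp del: of_real_sum)
    \<comment> \<open>The support of \<open>a T j\<close> has parity \<open>acc j\<close>. Once the
      other coefficients are set to 0, the sum can be extended to all \<open>k\<close>, where
      orthonormality applies.\<close>
    also have "\<dots> = (\<Sum>k | k < D \<and> odd k = v. (\<Sum>j\<in>J. (if acc j = v then \<psi> j else 0) * a T j k)\<^sup>2)"
    proof (intro sum.cong refl arg_cong [of _ _ "\<lambda>x. x\<^sup>2"])
      fix k j
      assume "k \<in> {k. k < D \<and> odd k = v}"
      then have "a T j k = 0" if "acc j \<noteq> v"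
        using that a_support e_odd by blast
      then show "\<psi> j * a T j k = (if acc j = v then \<psi> j else 0) * a T j k"
        by simp
    qed
    also have "\<dots> = (\<Sum>k<D. (\<Sum>j\<in>J. (if acc j = v then \<psi> j else 0) * a T j k)\<^sup>2)"
    proof (rule sum.mono_neutral_left)
      show "\<forall>k\<in>{..<D} - {k. k < D \<and> odd k = v}. (\<Sum>j\<in>J. (if acc j = v then \<psi> j else 0) * a T j k)\<^sup>2 = 0"
      proof
        fix k
        assume "k \<in> {..<D} - {k. k < D \<and> odd k = v}"
        then have "(if acc j = v then \<psi> j else 0) * a T j k = 0" for j
          using a_support [of T j k] e_odd by auto
        then show "(\<Sum>j\<in>J. (if acc j = v then \<psi> j else 0) * a T j k)\<^sup>2 = 0"
          by simp
      qed
    qed auto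
    also have "\<dots> = (\<Sum>j\<in>J. (if acc j = v then \<psi> j else 0) * (if acc j = v then \<psi> j else 0))"
      unfolding power2_eq_square by (rule ortho_comb) simp
    also have "\<dots> = (\<Sum>j | j \<in> J \<and> acc j = v. (\<psi> j)\<^sup>2)"
      by (subst sum.inter_filter [OF J], intro sum.cong refl) (simp add: power2_eq_square)
    finally show ?thesis .
  qed
  ultimately show ?thesis
    by (intro exI [of _ m] exI [of _ U]) simp
qed

section \<open>Sine vectors and Grover iterations\<close>

text \<open>Multiplication by \<open>2 * sin (x / 2)\<close> telescopes the sum; the bounds on
  \<open>p\<close> keep this factor positive.\<close>

lemma sum_cos_multiples:
  assumes "0 < p" "p < 2 * n"
  shows "(\<Sum>t<n. cos (pi * real p * real t / real n)) = (1 - (-1) ^ p) / 2"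
proof -
  define x where "x = pi * real p / real n"
  have n: "n > 0"
    using assms by simp
  have "0 < x / 2" "x / 2 < pi"
    using assms n by (simp_all add: x_def field_simps flip: of_nat_mult)
  then have s: "sin (x / 2) > 0"
    by (rule sin_gt_zero)
  have tel: "2 * sin (x / 2) * (\<Sum>t<k. cos (x * real t)) = sin (x * real k - x / 2) + sin (x / 2)" for k
  proof (induction k)
    case (Suc k)
    have "2 * sin (x / 2) * (\<Sum>t<Suc k. cos (x * real t))
        = sin (x * real k - x / 2) + sin (x / 2) + 2 * sin (x / 2) * cos (x * real k)"
      using Suc by (simp add: algebra_simps)
    also have "\<dots> = sin (x * real k + x / 2) + sin (x / 2)"
      by (simp add: sin_add sin_diff)
    also have "x * real k + x / 2 = x * real (Suc k) - x / 2"
      by (simp add: algebra_simps)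
    finally show ?case .
  qed simp
  have "x * real n - x / 2 = real p * pi - x / 2"
    using n by (simp add: x_def)
  then have "sin (x * real n - x / 2) = - ((-1) ^ p * sin (x / 2))"
    by (simp add: sin_diff)
  then have "2 * sin (x / 2) * (\<Sum>t<n. cos (x * real t)) = 2 * sin (x / 2) * ((1 - (-1) ^ p) / 2)"
    unfolding tel by (simp add: algebra_simps)
  then have "(\<Sum>t<n. cos (x * real t)) = (1 - (-1) ^ p) / 2"
    using s by simp
  then show ?thesis
    by (simp add: x_def)
qed

text \<open>The discrete sine transform of type I: for indices in \<open>1..T\<close> a symmetric
  orthogonal matrix. The values 0 and \<open>Suc T\<close> of \<open>t\<close> are boundary points
  where the vector vanishes.\<close>

definition sine_vec :: "nat \<Rightarrow> nat \<Rightarrow> nat \<Rightarrow> real" where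
  "sine_vec T j t = sqrt (2 / real (Suc T)) * sin (pi * real j * real t / real (Suc T))"

lemma sine_vec_commute: "sine_vec T j t = sine_vec T t j"
  by (simp add: sine_vec_def mult_ac)

lemma sine_vec_0 [simp]: "sine_vec T j 0 = 0"
  by (simp add: sine_vec_def)

lemma sine_vec_Suc_T [simp]: "sine_vec T j (Suc T) = 0"
proof -
  have "pi * real j * real (Suc T) / real (Suc T) = real j * pi"
    by (simp add: field_simps)
  then show ?thesis
    by (simp only: sine_vec_def sin_npi mult_zero_right)
qed

text \<open>The eigenvector equation for the adjacency matrix of the path, from the addition
  theorems for the sine.\<close>

lemma sine_vec_recurrence:
  "sine_vec T j (Suc (Suc t)) + sine_vec T j t = 2 * cos (pi * real j / real (Suc T)) * sine_vec T j (Suc t)"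
proof -
  define x where "x = pi * real j / real (Suc T)"
  have e: "sine_vec T j t = sqrt (2 / real (Suc T)) * sin (x * real t)" for t
    by (simp add: sine_vec_def x_def)
  define y where "y = x * real (Suc t)"
  have "x * real (Suc (Suc t)) = y + x" "x * real t = y - x"
    by (simp_all add: y_def algebra_simps)
  then have "sin (x * real (Suc (Suc t))) + sin (x * real t) = 2 * cos x * sin y"
    by (simp add: sin_add sin_diff del: of_nat_Suc)
  then show ?thesis
    unfolding e x_def [symmetric] y_def [symmetric] by (simp only: mult.left_commute distrib_left [symmetric])
qed

text \<open>Products of sines become differences of cosines with frequencies \<open>j - l\<close>
  and \<open>j + l\<close>. These have equal parity, so for \<open>j \<noteq> l\<close> the two
  cosine sums cancel.\<close>

lemma sine_vec_orthonormal:
  assumes "j \<in> {1..T}" "l \<in> {1..T}"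
  shows "(\<Sum>t=1..T. sine_vec T j t * sine_vec T l t) = (if j = l then 1 else 0)"
proof -
  define n where "n = Suc T"
  have *: "(\<Sum>t<n. sin (pi * real j * real t / real n) * sin (pi * real l * real t / real n))
      = (if j = l then real n / 2 else 0)" if "l \<le> j" "0 < l" "j < n" for j l
  proof -
    have "(\<Sum>t<n. sin (pi * real j * real t / real n) * sin (pi * real l * real t / real n))
        = (\<Sum>t<n. (cos (pi * real (j - l) * real t / real n) - cos (pi * real (j + l) * real t / real n)) / 2)"
    proof (intro sum.cong refl)
      fix t
      have "pi * real (j - l) * real t / real n = pi * real j * real t / real n - pi * real l * real t / real n"
           "pi * real (j + l) * real t / real n = pi * real j * real t / real n + pi * real l * real t / real n"
        using that by (simp_all add: of_nat_diff algebra_simps add_divide_distrib diff_divide_distrib)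
      then show "sin (pi * real j * real t / real n) * sin (pi * real l * real t / real n)
          = (cos (pi * real (j - l) * real t / real n) - cos (pi * real (j + l) * real t / real n)) / 2"
        by (simp only: sin_times_sin)
    qed
    also have "\<dots> = ((\<Sum>t<n. cos (pi * real (j - l) * real t / real n))
        - (\<Sum>t<n. cos (pi * real (j + l) * real t / real n))) / 2"
      by (simp only: sum_subtractf flip: sum_divide_distrib)
    also have "(\<Sum>t<n. cos (pi * real (j + l) * real t / real n)) = (1 - (-1) ^ (j + l)) / 2"
      using that by (intro sum_cos_multiples) auto
    also have "(\<Sum>t<n. cos (pi * real (j - l) * real t / real n)) = (if j = l then real n else (1 - (-1) ^ (j - l)) / 2)"
      using that sum_cos_multiples [of "j - l" n] by (cases "j = l") auto
    also have "(-1 :: real) ^ (j + l) = (-1) ^ (j - l)"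
      using that by (simp add: minus_one_power_iff)
    finally show ?thesis
      by auto
  qed
  have "(\<Sum>t<n. sin (pi * real j * real t / real n) * sin (pi * real l * real t / real n))
      = (if j = l then real n / 2 else 0)"
    using *[of l j] *[of j l] assms by (cases "l \<le> j") (auto simp: n_def mult.commute)
  moreover have "(\<Sum>t=1..T. sine_vec T j t * sine_vec T l t) = (\<Sum>t<n. sine_vec T j t * sine_vec T l t)"
    by (intro sum.mono_neutral_left) (auto simp: n_def Suc_le_eq)
  moreover have "(\<Sum>t<n. sine_vec T j t * sine_vec T l t) = 2 / real n *
      (\<Sum>t<n. sin (pi * real j * real t / real n) * sin (pi * real l * real t / real n))"
  proof -
    have "sine_vec T j t * sine_vec T l t
        = (sqrt (2 / real n) * sqrt (2 / real n)) * (sin (pi * real j * real t / real n) * sin (pi * real l * real t / real n))" for t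
      by (simp only: sine_vec_def n_def mult_ac)
    then show ?thesis
      by (simp add: sum_distrib_left)
  qed
  ultimately show ?thesis
    by (simp add: n_def)
qed

text \<open>By symmetry of the matrix, orthonormality of its rows is also that of its columns, so
  the transform preserves length.\<close>

lemma sine_vec_Parseval:
  "(\<Sum>j=1..T. (\<Sum>t=1..T. sine_vec T j t * y t)\<^sup>2) = (\<Sum>t=1..T. (y t)\<^sup>2)"
proof -
  have "(\<Sum>j=1..T. (\<Sum>t=1..T. sine_vec T j t * y t)\<^sup>2)
      = (\<Sum>j=1..T. \<Sum>t=1..T. \<Sum>s=1..T. y t * y s * (sine_vec T t j * sine_vec T s j))"
    unfolding power2_eq_square sum_product by (simp add: sine_vec_commute [of T _] mult_ac)
  also have "\<dots> = (\<Sum>t=1..T. \<Sum>s=1..T. y t * y s * (\<Sum>j=1..T. sine_vec T t j * sine_vec T s j))"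
    unfolding sum_distrib_left by (rule trans [OF sum.swap sum.cong [OF refl sum.swap]])
  also have "\<dots> = (\<Sum>t=1..T. \<Sum>s=1..T. y t * ((if t = s then 1 else 0) * y s))"
    by (intro sum.cong refl) (simp only: sine_vec_orthonormal mult_ac)
  also have "\<dots> = (\<Sum>t=1..T. (y t)\<^sup>2)"
    unfolding sum_distrib_left [symmetric]
    by (intro sum.cong refl) (simp only: sum_delta_mult finite_atLeastAtMost power2_eq_square)
  finally show ?thesis .
qed

text \<open>Moves a shift from one factor to the other; the conditions kill the boundary
  terms.\<close>

lemma sum_shift_Suc:
  fixes a b :: "nat \<Rightarrow> real"
  assumes "a (Suc T) = 0" "b 0 = 0"
  shows "(\<Sum>t=1..T. a (Suc t) * b t) = (\<Sum>t=1..T. a t * b (t - 1))"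
proof -
  have "(\<Sum>t=1..T. a (Suc t) * b t) = (\<Sum>t=0..T. a (Suc t) * b t)"
    using assms by (simp add: sum.atLeast_Suc_atMost [of 0])
  also have "\<dots> = (\<Sum>t=Suc 0..Suc T. a t * b (t - 1))"
    by (simp only: sum.shift_bounds_cl_Suc_ivl diff_Suc_1)
  also have "\<dots> = (\<Sum>t=1..T. a t * b (t - 1))"
    using assms by simp
  finally show ?thesis .
qed

text \<open>The vectors \<open>sine_vec T j\<close> diagonalise the symmetric matrix with entries \<open>1/2\<close> next to
  the diagonal; \<open>A\<close> vanishes at both ends, so that matrix can be moved onto \<open>A\<close>.\<close>

lemma sine_vec_eigenvalue:
  fixes A :: "nat \<Rightarrow> real"
  assumes "A 0 = 0" "A (Suc T) = 0"
  shows "cos (pi * real j / real (Suc T)) * (\<Sum>t=1..T. sine_vec T j t * A t)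
    = (\<Sum>t=1..T. sine_vec T j t * ((A (Suc t) + A (t - 1)) / 2))"
proof -
  have "2 * (cos (pi * real j / real (Suc T)) * (\<Sum>t=1..T. sine_vec T j t * A t))
      = (\<Sum>t=1..T. (sine_vec T j (Suc t) + sine_vec T j (t - 1)) * A t)"
    unfolding sum_distrib_left
  proof (intro sum.cong refl)
    fix t
    assume "t \<in> {1..T}"
    then obtain s where "t = Suc s"
      by (cases t) auto
    then show "2 * (cos (pi * real j / real (Suc T)) * (sine_vec T j t * A t))
        = (sine_vec T j (Suc t) + sine_vec T j (t - 1)) * A t"
      using sine_vec_recurrence [of T j s] by (simp only: diff_Suc_1 mult.assoc)
  qed
  also have "\<dots> = (\<Sum>t=1..T. sine_vec T j (Suc t) * A t) + (\<Sum>t=1..T. A t * sine_vec T j (t - 1))"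
    by (simp add: algebra_simps sum.distrib)
  also have "(\<Sum>t=1..T. sine_vec T j (Suc t) * A t) = (\<Sum>t=1..T. sine_vec T j t * A (t - 1))"
    using assms by (intro sum_shift_Suc) auto
  also have "(\<Sum>t=1..T. A t * sine_vec T j (t - 1)) = (\<Sum>t=1..T. A (Suc t) * sine_vec T j t)"
    using assms by (intro sum_shift_Suc [symmetric]) auto
  also have "(\<Sum>t=1..T. sine_vec T j t * A (t - 1)) + (\<Sum>t=1..T. A (Suc t) * sine_vec T j t)
      = 2 * (\<Sum>t=1..T. sine_vec T j t * ((A (Suc t) + A (t - 1)) / 2))"
    unfolding sum_distrib_left sum.distrib [symmetric] by (intro sum.cong) (auto simp: algebra_simps)
  finally show ?thesis
    by simp
qed

section \<open>Grover's iteration as a rotation of a plane\<close>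

definition diffusion :: "nat \<Rightarrow> nat \<Rightarrow> nat \<Rightarrow> real" where
  "diffusion N i j = 2 / real N - (if i = j then 1 else 0)"

definition bit_sign :: "bool list \<Rightarrow> nat \<Rightarrow> real" where
  "bit_sign X i = (if X ! i then -1 else 1)"

fun grover :: "bool list \<Rightarrow> nat \<Rightarrow> nat \<Rightarrow> real" where
  "grover X 0 i = 1 / sqrt (real (length X))"
| "grover X (Suc r) i = (\<Sum>j<length X. diffusion (length X) i j * (bit_sign X j * grover X r j))"

text \<open>The mean of the signs \<open>bit_sign X i\<close>. It is the cosine of the rotation
  angle: the squared sine of half that angle is the fraction of ones.\<close>

definition grover_cos :: "bool list \<Rightarrow> real" where
  "grover_cos X = 1 - 2 * real (count_list X True) / real (length X)"

lemma diffusion_apply: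
  "i < N \<Longrightarrow> (\<Sum>j<N. diffusion N i j * f j) = 2 / real N * (\<Sum>j<N. f j) - f i"
  by (simp add: diffusion_def left_diff_distrib sum_subtractf sum_delta_mult sum_distrib_left)

lemma diffusion_orthonormal:
  assumes "i < N" "j < N"
  shows "(\<Sum>k<N. diffusion N k i * diffusion N k j) = (if i = j then 1 else 0)"
proof -
  have sym: "diffusion N k i = diffusion N i k" for k
    by (auto simp: diffusion_def)
  have "(\<Sum>k<N. diffusion N k j) = 1"
    using assms by (simp add: diffusion_def sum_subtractf)
  then show ?thesis
    unfolding sym diffusion_apply [OF assms(1)] by (simp add: diffusion_def)
qed

lemma bit_sign_square [simp]: "bit_sign X i * bit_sign X i = 1"
  by (simp add: bit_sign_def)

context
  fixes X :: "bool list" and N :: nat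
  assumes X: "length X = N" and N: "N > 0"
begin

lemma sum_bit_sign: "(\<Sum>i<N. bit_sign X i) = real N * grover_cos X"
proof -
  have "(\<Sum>i<N. bit_sign X i) = (\<Sum>i<N. 1 - 2 * (if X ! i then 1 else 0))"
    by (intro sum.cong) (auto simp: bit_sign_def)
  also have "\<dots> = real N - 2 * (\<Sum>i<N. if X ! i then 1 else 0)"
    by (simp only: sum_subtractf sum_distrib_left) simp
  also have "(\<Sum>i<N. if X ! i then 1 else (0::real)) = real (card {i. i < N \<and> X ! i})"
    by (simp add: sum.If_cases Int_def)
  also have "real N - 2 * real (card {i. i < N \<and> X ! i}) = real N * grover_cos X"
    using X N by (simp add: grover_cos_def count_list_eq_length_filter length_filter_conv_card right_diff_distrib)
  finally show ?thesis .
qed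

lemma grover_Suc: "i < N \<Longrightarrow> grover X (Suc r) i = 2 / real N * (\<Sum>j<N. bit_sign X j * grover X r j) - bit_sign X i * grover X r i"
  using X by (simp add: diffusion_apply)

text \<open>A plane rotation \<open>R\<close> with cosine \<open>c\<close> satisfies
  \<open>R^2 = 2 c R - 1\<close>. No plane is constructed here: the identity is computed on the
  uniform start vector and carried along the orbit by linearity.\<close>

lemma grover_recurrence:
  assumes "i < N"
  shows "grover X (Suc (Suc r)) i = 2 * grover_cos X * grover X (Suc r) i - grover X r i"
  using assms
proof (induction r arbitrary: i)
  case 0
  define s where "s = 1 / sqrt (real N)"
  define c where "c = grover_cos X"
  have g0: "grover X 0 i = s" for i
    using X by (simp add: s_def)
  have g1: "grover X (Suc 0) i = 2 * c * s - bit_sign X i * s" if "i < N" for i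
    unfolding grover_Suc [OF that] g0 sum_distrib_right [symmetric] sum_bit_sign
    using N by (simp add: c_def)
  have "(\<Sum>j<N. bit_sign X j * grover X (Suc 0) j) = (\<Sum>j<N. bit_sign X j * (2 * c * s) - s)"
    by (intro sum.cong refl) (simp add: g1 right_diff_distrib flip: mult.assoc del: grover.simps)
  also have "\<dots> = real N * c * (2 * c * s) - real N * s"
    unfolding sum_subtractf sum_distrib_right [symmetric] sum_bit_sign c_def by simp
  finally have "grover X (Suc (Suc 0)) i = 2 / real N * (real N * c * (2 * c * s) - real N * s) - bit_sign X i * grover X (Suc 0) i"
    unfolding grover_Suc [OF 0] by simp
  also have "\<dots> = 2 * c * (2 * c * s) - 2 * s - bit_sign X i * grover X (Suc 0) i"
    using N by (simp add: field_simps)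
  also have "bit_sign X i * grover X (Suc 0) i = 2 * c * (bit_sign X i * s) - s"
    unfolding g1 [OF 0] by (simp add: right_diff_distrib flip: mult.assoc)
  finally show ?case
    unfolding g0 g1 [OF 0] c_def [symmetric] by (simp add: algebra_simps)
next
  case (Suc r)
  define c where "c = grover_cos X"
  have "(\<Sum>j<N. bit_sign X j * grover X (Suc (Suc r)) j)
      = (\<Sum>j<N. 2 * c * (bit_sign X j * grover X (Suc r) j) - bit_sign X j * grover X r j)"
  proof (intro sum.cong refl)
    fix j
    assume "j \<in> {..<N}"
    then have "grover X (Suc (Suc r)) j = 2 * c * grover X (Suc r) j - grover X r j"
      using Suc.IH by (simp add: c_def del: grover.simps)
    then show "bit_sign X j * grover X (Suc (Suc r)) j = 2 * c * (bit_sign X j * grover X (Suc r) j) - bit_sign X j * grover X r j"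
      by (simp add: right_diff_distrib mult.left_commute del: grover.simps)
  qed
  also have "\<dots> = 2 * c * (\<Sum>j<N. bit_sign X j * grover X (Suc r) j) - (\<Sum>j<N. bit_sign X j * grover X r j)"
    by (simp only: sum_subtractf sum_distrib_left)
  finally have S: "(\<Sum>j<N. bit_sign X j * grover X (Suc (Suc r)) j)
      = 2 * c * (\<Sum>j<N. bit_sign X j * grover X (Suc r) j) - (\<Sum>j<N. bit_sign X j * grover X r j)" .
  have "grover X (Suc (Suc (Suc r))) i = 2 / real N * (\<Sum>j<N. bit_sign X j * grover X (Suc (Suc r)) j)
      - bit_sign X i * grover X (Suc (Suc r)) i"
    using Suc.prems by (rule grover_Suc)
  also have "\<dots> = 2 * c * (2 / real N * (\<Sum>j<N. bit_sign X j * grover X (Suc r) j) - bit_sign X i * grover X (Suc r) i)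
      - (2 / real N * (\<Sum>j<N. bit_sign X j * grover X r j) - bit_sign X i * grover X r i)"
    unfolding S Suc.IH [OF Suc.prems] c_def [symmetric] by (simp add: algebra_simps del: grover.simps)
  also have "\<dots> = 2 * c * grover X (Suc (Suc r)) i - grover X (Suc r) i"
    by (simp only: grover_Suc [OF Suc.prems])
  finally show ?case
    unfolding c_def .
qed

lemma grover_inner_Suc:
  "(\<Sum>i<N. grover X (Suc r) i * grover X (Suc s) i) = (\<Sum>i<N. grover X r i * grover X s i)"
proof -
  define f where "f r i = bit_sign X i * grover X r i" for r i
  have "(\<Sum>i<N. grover X (Suc r) i * grover X (Suc s) i)
      = (\<Sum>k<N. \<Sum>i<N. \<Sum>j<N. f r i * f s j * (diffusion N k i * diffusion N k j))"
    using X unfolding grover.simps sum_product f_def by (simp add: mult_ac)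
  also have "\<dots> = (\<Sum>i<N. \<Sum>j<N. f r i * f s j * (\<Sum>k<N. diffusion N k i * diffusion N k j))"
    unfolding sum_distrib_left by (rule trans [OF sum.swap sum.cong [OF refl sum.swap]])
  also have "\<dots> = (\<Sum>i<N. \<Sum>j<N. f r i * ((if i = j then 1 else 0) * f s j))"
    by (intro sum.cong refl) (simp add: diffusion_orthonormal)
  also have "\<dots> = (\<Sum>i<N. f r i * f s i)"
    unfolding sum_distrib_left [symmetric] by (intro sum.cong refl) (simp add: sum_delta_mult)
  also have "\<dots> = (\<Sum>i<N. (bit_sign X i * bit_sign X i) * (grover X r i * grover X s i))"
    unfolding f_def by (simp only: mult_ac)
  finally show ?thesis
    by simp
qed

lemma grover_norm: "(\<Sum>i<N. (grover X r i)\<^sup>2) = 1"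
proof (induction r)
  case 0
  then show ?case
    using X N by (simp add: power_divide)
next
  case (Suc r)
  then show ?case
    using grover_inner_Suc [of r r] by (simp only: power2_eq_square)
qed

text \<open>The iteration is orthogonal, so the angle between successive iterates never changes; at
  the start its cosine is the mean of the signs.\<close>

lemma grover_inner_next: "(\<Sum>i<N. grover X r i * grover X (Suc r) i) = grover_cos X"
proof (induction r)
  case 0
  define s where "s = 1 / sqrt (real N)"
  have s: "s * s = 1 / real N"
    using N by (simp add: s_def)
  have g0: "grover X 0 i = s" for i
    using X by (simp add: s_def)
  have "(\<Sum>i<N. grover X 0 i * grover X (Suc 0) i) = (\<Sum>i<N. s * s * (2 * grover_cos X - bit_sign X i))"
    unfolding g0
  proof (intro sum.cong refl)
    fix i
    assume "i \<in> {..<N}"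
    then have i: "i < N"
      by simp
    show "s * grover X (Suc 0) i = s * s * (2 * grover_cos X - bit_sign X i)"
      unfolding grover_Suc [OF i] g0 sum_distrib_right [symmetric] sum_bit_sign
      using N by (simp add: field_simps)
  qed
  also have "\<dots> = grover_cos X"
    unfolding sum_distrib_left [symmetric] sum_subtractf sum_bit_sign s using N by simp
  finally show ?case .
next
  case (Suc r)
  then show ?case
    using grover_inner_Suc [of r "Suc r"] by simp
qed

text \<open>The component of the next iterate orthogonal to the current one. It is left unnormalised
  because it vanishes when the cosine is 1 or -1.\<close>

definition grover_perp :: "nat \<Rightarrow> nat \<Rightarrow> real" where
  "grover_perp t i = grover X (Suc t) i - grover_cos X * grover X t i"

text \<open>Pythagoras: \<open>grover_perp t\<close> is orthogonal to the unit vector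
  \<open>grover X t\<close> and has squared length \<open>1 - c^2\<close>, where \<open>c\<close> is
  \<open>grover_cos X\<close>.\<close>

lemma grover_perp_comb:
  "(\<Sum>i<N. (p * grover X t i + q * grover_perp t i)\<^sup>2) = p\<^sup>2 + q\<^sup>2 * (1 - (grover_cos X)\<^sup>2)"
proof -
  define c where "c = grover_cos X"
  define u where "u = grover X t"
  define v where "v = grover X (Suc t)"
  have uv: "(\<Sum>i<N. (u i)\<^sup>2) = 1" "(\<Sum>i<N. (v i)\<^sup>2) = 1" "(\<Sum>i<N. u i * v i) = c"
    unfolding u_def v_def c_def by (rule grover_norm grover_inner_next)+
  have "(p * u i + q * (v i - c * u i))\<^sup>2 = (p - q * c)\<^sup>2 * (u i)\<^sup>2 + q\<^sup>2 * (v i)\<^sup>2 + 2 * q * (p - q * c) * (u i * v i)" for i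
    by (simp add: power2_eq_square algebra_simps)
  then have "(\<Sum>i<N. (p * u i + q * (v i - c * u i))\<^sup>2) = (p - q * c)\<^sup>2 + q\<^sup>2 + 2 * q * (p - q * c) * c"
    by (simp add: sum.distrib uv flip: sum_distrib_left)
  also have "\<dots> = p\<^sup>2 + q\<^sup>2 * (1 - c\<^sup>2)"
    by (simp add: power2_eq_square algebra_simps)
  finally show ?thesis
    unfolding grover_perp_def u_def v_def c_def .
qed

text \<open>The amplitude of \<open>(j, i)\<close> after the sine transform of the time register.
  The weights \<open>sine_vec T 1 t\<close> are the top eigenvector of the path: they vary slowly
  and vanish at both ends.\<close>

definition final_amp :: "nat \<Rightarrow> nat \<Rightarrow> nat \<Rightarrow> real" where
  "final_amp T j i = (\<Sum>t=1..T. sine_vec T j t * (sine_vec T 1 t * grover X t i))"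

lemma final_amp_norm:
  assumes "T > 0"
  shows "(\<Sum>j=1..T. \<Sum>i<N. (final_amp T j i)\<^sup>2) = 1"
proof -
  have "(\<Sum>j=1..T. \<Sum>i<N. (final_amp T j i)\<^sup>2) = (\<Sum>i<N. \<Sum>j=1..T. (final_amp T j i)\<^sup>2)"
    by (rule sum.swap)
  also have "\<dots> = (\<Sum>i<N. \<Sum>t=1..T. (sine_vec T 1 t * grover X t i)\<^sup>2)"
    unfolding final_amp_def sine_vec_Parseval ..
  also have "\<dots> = (\<Sum>t=1..T. (sine_vec T 1 t)\<^sup>2 * (\<Sum>i<N. (grover X t i)\<^sup>2))"
    unfolding power_mult_distrib sum_distrib_left by (rule sum.swap)
  also have "\<dots> = 1"
    using sine_vec_orthonormal [of 1 T 1] assms unfolding grover_norm by (simp add: power2_eq_square)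
  finally show ?thesis .
qed

text \<open>Multiplying an amplitude by eigenvalue minus \<open>c\<close> amounts to replacing the
  time sequence by its neighbour average minus \<open>c\<close> times itself. The addition theorems
  split the result into a \<open>1 - cos \<alpha>\<close> part along the current iterate and a
  \<open>sin \<alpha>\<close> part orthogonal to it; Parseval and Pythagoras add their
  squares.\<close>

lemma final_amp_variance:
  assumes "T > 0"
  defines "\<alpha> \<equiv> pi / real (Suc T)"
  shows "(\<Sum>j=1..T. \<Sum>i<N. (cos (pi * real j / real (Suc T)) - grover_cos X)\<^sup>2 * (final_amp T j i)\<^sup>2)
    \<le> (1 - cos \<alpha>)\<^sup>2 + (sin \<alpha>)\<^sup>2 * (1 - (grover_cos X)\<^sup>2)"
proof -
  define c where "c = grover_cos X"
  define K where "K = sqrt (2 / real (Suc T))"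
  define p where "p t = (cos \<alpha> - 1) * c * sine_vec T 1 t" for t
  define q where "q t = sin \<alpha> * (K * cos (\<alpha> * real t))" for t
  define y where "y i t = p t * grover X t i + q t * grover_perp t i" for i t
  have e1: "sine_vec T 1 t = K * sin (\<alpha> * real t)" for t
    by (simp add: sine_vec_def K_def \<alpha>_def)
  have amp: "(cos (pi * real j / real (Suc T)) - c) * final_amp T j i = (\<Sum>t=1..T. sine_vec T j t * y i t)"
    if i: "i < N" for i j
  proof -
    define A where "A t = sine_vec T 1 t * grover X t i" for t
    have "(cos (pi * real j / real (Suc T)) - c) * final_amp T j i
        = cos (pi * real j / real (Suc T)) * (\<Sum>t=1..T. sine_vec T j t * A t) - c * (\<Sum>t=1..T. sine_vec T j t * A t)"
      unfolding final_amp_def A_def by (rule left_diff_distrib)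
    also have "cos (pi * real j / real (Suc T)) * (\<Sum>t=1..T. sine_vec T j t * A t)
        = (\<Sum>t=1..T. sine_vec T j t * ((A (Suc t) + A (t - 1)) / 2))"
      by (rule sine_vec_eigenvalue) (simp_all add: A_def)
    also have "\<dots> - c * (\<Sum>t=1..T. sine_vec T j t * A t)
        = (\<Sum>t=1..T. sine_vec T j t * ((A (Suc t) + A (t - 1)) / 2 - c * A t))"
      unfolding sum_distrib_left sum_subtractf [symmetric] by (simp add: algebra_simps)
    also have "\<dots> = (\<Sum>t=1..T. sine_vec T j t * y i t)"
    proof (intro sum.cong refl arg_cong [of _ _ "(*) _"])
      fix t
      assume "t \<in> {1..T}"
      then obtain s where s: "t = Suc s"
        by (cases t) auto
      have up: "grover X (Suc t) i = c * grover X t i + grover_perp t i"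
        by (simp only: grover_perp_def c_def add_diff_cancel_left' add_diff_eq)
      \<comment> \<open>The recurrence read backwards: the previous iterate mirrors the next one, so
        the orthogonal parts enter with opposite signs.\<close>
      then have down: "grover X (t - 1) i = c * grover X t i - grover_perp t i"
        using grover_recurrence [OF i, of s] by (simp add: s c_def del: grover.simps)
      have su: "sine_vec T 1 (Suc t) = K * (sin (\<alpha> * real t) * cos \<alpha> + cos (\<alpha> * real t) * sin \<alpha>)"
        unfolding e1 by (simp add: distrib_left sin_add add.commute)
      have "\<alpha> * real (t - 1) = \<alpha> * real t - \<alpha>"
        by (simp add: s algebra_simps)
      then have sd: "sine_vec T 1 (t - 1) = K * (sin (\<alpha> * real t) * cos \<alpha> - cos (\<alpha> * real t) * sin \<alpha>)"
        unfolding e1 by (simp only: sin_diff)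
      show "(A (Suc t) + A (t - 1)) / 2 - c * A t = y i t"
        unfolding A_def su sd unfolding up down y_def p_def q_def e1 by (simp add: field_simps)
    qed
    finally show ?thesis .
  qed
  have e1_norm: "(\<Sum>t=1..T. (sine_vec T 1 t)\<^sup>2) = 1"
    using sine_vec_orthonormal [of 1 T 1] assms by (simp add: power2_eq_square)
  have "(\<Sum>j=1..T. \<Sum>i<N. (cos (pi * real j / real (Suc T)) - c)\<^sup>2 * (final_amp T j i)\<^sup>2)
      = (\<Sum>j=1..T. \<Sum>i<N. (\<Sum>t=1..T. sine_vec T j t * y i t)\<^sup>2)"
    by (intro sum.cong refl) (simp only: lessThan_iff amp [symmetric] power_mult_distrib)
  also have "\<dots> = (\<Sum>i<N. \<Sum>t=1..T. (y i t)\<^sup>2)"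
    by (subst sum.swap) (simp only: sine_vec_Parseval)
  also have "\<dots> = (\<Sum>t=1..T. (p t)\<^sup>2 + (q t)\<^sup>2 * (1 - c\<^sup>2))"
    unfolding y_def by (subst sum.swap) (simp only: grover_perp_comb c_def)
  also have "\<dots> = (\<Sum>t=1..T. (p t)\<^sup>2) + (\<Sum>t=1..T. (q t)\<^sup>2) * (1 - c\<^sup>2)"
    by (simp add: sum.distrib sum_distrib_right)
  also have "\<dots> \<le> (1 - cos \<alpha>)\<^sup>2 + (sin \<alpha>)\<^sup>2 * (1 - c\<^sup>2)"
  proof (intro add_mono mult_right_mono)
    have c1: "c\<^sup>2 \<le> 1"
    proof -
      \<comment> \<open>\<open>1 - c^2\<close> is the squared length of
        \<open>grover_perp 0\<close>, hence nonnegative.\<close>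
      have "0 \<le> (\<Sum>i<N. (0 * grover X 0 i + 1 * grover_perp 0 i)\<^sup>2)"
        by (intro sum_nonneg) simp
      then show ?thesis
        unfolding grover_perp_comb by (simp add: c_def)
    qed
    then show "0 \<le> 1 - c\<^sup>2"
      by simp
    have "(\<Sum>t=1..T. (p t)\<^sup>2) = (1 - cos \<alpha>)\<^sup>2 * c\<^sup>2"
      unfolding p_def power_mult_distrib by (simp only: e1_norm sum_distrib_left [symmetric]) (simp add: power2_commute)
    also have "\<dots> \<le> (1 - cos \<alpha>)\<^sup>2"
      using c1 by (simp add: mult_left_le)
    finally show "(\<Sum>t=1..T. (p t)\<^sup>2) \<le> (1 - cos \<alpha>)\<^sup>2" .
    have K2: "K\<^sup>2 = 2 / real (Suc T)"
      by (simp add: K_def)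
    have "(K * cos (\<alpha> * real t))\<^sup>2 = K\<^sup>2 - (sine_vec T 1 t)\<^sup>2" for t
      unfolding e1 power_mult_distrib cos_squared_eq by (simp add: algebra_simps)
    then have "(\<Sum>t=1..T. (K * cos (\<alpha> * real t))\<^sup>2) = real T * K\<^sup>2 - 1"
      by (simp only: sum_subtractf e1_norm sum_constant card_atLeastAtMost add_diff_cancel_right' Suc_eq_plus1)
    \<comment> \<open>The value is \<open>2 * T / (T + 1) - 1\<close>.\<close>
    also have "\<dots> \<le> 1"
      unfolding K2 by (simp add: field_simps)
    finally have "(\<Sum>t=1..T. (K * cos (\<alpha> * real t))\<^sup>2) \<le> 1" .
    then show "(\<Sum>t=1..T. (q t)\<^sup>2) \<le> (sin \<alpha>)\<^sup>2"
      unfolding q_def power_mult_distrib [of "sin \<alpha>"] sum_distrib_left [symmetric]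
      by (simp add: mult_left_le)
  qed
  finally show ?thesis
    unfolding c_def .
qed

end

section \<open>The threshold functions\<close>

text \<open>Chebyshev's inequality for the weights \<open>f\<close>, with \<open>B\<close> as the
  set of outcomes far from \<open>c\<close>.\<close>

lemma prob_wrong_side_le:
  fixes lam f :: "'a \<Rightarrow> real"
  assumes "finite J" "D > 0" "\<And>j. j \<in> B \<Longrightarrow> D \<le> (lam j - c)\<^sup>2" "B \<subseteq> J"
    and "\<And>j. 0 \<le> f j"
    and "(\<Sum>j\<in>J. (lam j - c)\<^sup>2 * f j) \<le> E"
  shows "(\<Sum>j\<in>B. f j) \<le> E / D"
proof -
  have "D * (\<Sum>j\<in>B. f j) \<le> (\<Sum>j\<in>B. (lam j - c)\<^sup>2 * f j)"
    unfolding sum_distrib_left using assms by (intro sum_mono mult_right_mono) auto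
  also have "\<dots> \<le> (\<Sum>j\<in>J. (lam j - c)\<^sup>2 * f j)"
    using assms by (intro sum_mono2) auto
  finally show ?thesis
    using assms by (simp add: pos_le_divide_eq mult.commute)
qed

text \<open>With \<open>c = 1 - 2 * k / N\<close> the left side is
  \<open>(1 - c^2) * N^2 / 4\<close>, and the last square is \<open>N^2\<close> times the squared
  distance of \<open>c\<close> from the midpoint between the cosines for weights
  \<open>M - 1\<close> and \<open>M\<close>. So inputs far from the threshold may have a large
  variance, as their distance grows with it.\<close>

lemma threshold_gap:
  assumes "1 \<le> M" "M \<le> N" "k \<le> N"
  shows "real k * (real N - real k) \<le> real M * (real N - real M + 1) * (2 * real k - 2 * real M + 1)\<^sup>2"
proof (cases "M \<le> k")
  case True
  define r where "r = real k - real M"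
  define n where "n = real N - real M + 1"
  have r: "0 \<le> r" "1 \<le> real M" "1 \<le> n"
    using True assms by (simp_all add: r_def n_def)
  have "real k \<le> real M * (1 + r)"
    using r mult_right_mono [of 1 "real M" r] by (simp add: distrib_left r_def)
  moreover have "real N - real k \<le> n"
    using True by (simp add: n_def)
  ultimately have "real k * (real N - real k) \<le> (real M * (1 + r)) * n"
    using assms r by (intro mult_mono) auto
  also have "\<dots> = real M * n * (1 + r)"
    by (simp add: mult_ac)
  also have "\<dots> \<le> real M * n * (2 * r + 1)\<^sup>2"
    using r by (intro mult_left_mono) (auto simp: power2_eq_square algebra_simps)
  finally show ?thesis
    by (simp add: r_def n_def algebra_simps)
next
  case False
  define s where "s = real M - real k"
  define n where "n = real N - real M + 1"
  have s: "1 \<le> s" "1 \<le> real M" "1 \<le> n"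
    using False assms by (simp_all add: s_def n_def)
  have "real N - real k \<le> n * s"
  proof -
    have "0 \<le> (n - 1) * (s - 1)"
      using s by simp
    moreover have "real N - real k = n - 1 + s"
      by (simp add: n_def s_def)
    ultimately show ?thesis
      by (simp add: algebra_simps)
  qed
  then have "real k * (real N - real k) \<le> real M * (n * s)"
    using assms False by (intro mult_mono) auto
  also have "\<dots> = real M * n * s"
    by simp
  also have "s \<le> (2 * s - 1)\<^sup>2"
  proof -
    have "0 \<le> (s - 1) * (4 * s - 1)"
      using s by simp
    then show ?thesis
      by (simp add: power2_eq_square algebra_simps)
  qed
  then have "real M * n * s \<le> real M * n * (2 * s - 1)\<^sup>2"
    using s by (intro mult_left_mono) auto
  also have "(2 * s - 1)\<^sup>2 = (2 * real k - 2 * real M + 1)\<^sup>2"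
    by (simp add: s_def power2_eq_square algebra_simps)
  finally show ?thesis
    by (simp add: n_def)
qed

text \<open>Here \<open>1 - cos \<alpha>\<close> is at most \<open>\<alpha>^2 / 2\<close> and
  \<open>sin \<alpha>\<close> at most \<open>\<alpha>\<close> in absolute value. As
  \<open>N \<le> Q\<close>, the condition on \<open>\<alpha>\<close> controls both terms; the factor
  1/3 is the admissible error.\<close>

lemma variance_small:
  assumes "1 \<le> M" "M \<le> N" "k \<le> N" and \<alpha>: "0 \<le> \<alpha>" "\<alpha>\<^sup>2 * (16 * (real M * (real N - real M + 1))) \<le> 1"
  defines "c \<equiv> 1 - 2 * real k / real N"
  shows "(1 - cos \<alpha>)\<^sup>2 + (sin \<alpha>)\<^sup>2 * (1 - c\<^sup>2) \<le> ((2 * real k - 2 * real M + 1) / real N)\<^sup>2 / 3"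
proof -
  define Q where "Q = real M * (real N - real M + 1)"
  define g where "g = (2 * real k - 2 * real M + 1)\<^sup>2"
  have N: "real N > 0"
    using assms by simp
  have Q: "real N \<le> Q"
  proof -
    have "0 \<le> (real M - 1) * (real N - real M)"
      using assms by simp
    then show ?thesis
      by (simp add: Q_def algebra_simps)
  qed
  have \<alpha>Q: "\<alpha>\<^sup>2 * Q \<le> 1 / 16"
    using \<alpha>(2) by (simp add: Q_def algebra_simps)
  have \<alpha>N: "\<alpha>\<^sup>2 * real N \<le> 1 / 16"
    using mult_left_mono [OF Q, of "\<alpha>\<^sup>2"] \<alpha>Q by simp
  \<comment> \<open>\<open>g\<close> is the square of an odd integer.\<close>
  have g1: "1 \<le> g"
  proof -
    have "2 * int k - 2 * int M + 1 \<noteq> 0"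
      by presburger
    then have "1 \<le> (2 * int k - 2 * int M + 1)\<^sup>2"
      by (simp add: int_one_le_iff_zero_less)
    then have "real_of_int 1 \<le> real_of_int ((2 * int k - 2 * int M + 1)\<^sup>2)"
      by (simp only: of_int_le_iff)
    then show ?thesis
      by (simp add: g_def)
  qed
  have s: "\<bar>sin x\<bar> \<le> \<bar>x\<bar>" for x :: real
    by (rule abs_sin_x_le_abs_x)
  have s2: "(sin x)\<^sup>2 \<le> x\<^sup>2" for x :: real
    using s by (simp add: abs_le_square_iff)
  have "1 - cos \<alpha> = 2 * (sin (\<alpha> / 2))\<^sup>2"
    using cos_double_sin [of "\<alpha> / 2"] by simp
  also have "\<dots> \<le> \<alpha>\<^sup>2 / 2"
    using s2 [of "\<alpha> / 2"] by (simp add: power2_eq_square)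
  finally have "(1 - cos \<alpha>)\<^sup>2 \<le> (\<alpha>\<^sup>2 / 2)\<^sup>2"
    by (intro power_mono) auto
  then have "(1 - cos \<alpha>)\<^sup>2 * (real N)\<^sup>2 \<le> (\<alpha>\<^sup>2 / 2)\<^sup>2 * (real N)\<^sup>2"
    by (intro mult_right_mono) auto
  also have "\<dots> = (\<alpha>\<^sup>2 * real N)\<^sup>2 / 4"
    by (simp add: power2_eq_square)
  also have "\<dots> \<le> (1 / 16)\<^sup>2 / 4"
    using \<alpha>N by (intro divide_right_mono power_mono) auto
  finally have A: "(1 - cos \<alpha>)\<^sup>2 * (real N)\<^sup>2 \<le> g / 1024"
    using g1 by (simp add: power2_eq_square)
  have c: "(1 - c\<^sup>2) * (real N)\<^sup>2 = 4 * (real k * (real N - real k))"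
    using N by (simp add: c_def power2_eq_square field_simps)
  have "(sin \<alpha>)\<^sup>2 * (1 - c\<^sup>2) * (real N)\<^sup>2 = (sin \<alpha>)\<^sup>2 * (4 * (real k * (real N - real k)))"
    by (simp only: c mult.assoc)
  also have "\<dots> \<le> \<alpha>\<^sup>2 * (4 * (Q * g))"
  proof (rule mult_mono [OF s2])
    show "4 * (real k * (real N - real k)) \<le> 4 * (Q * g)"
      using threshold_gap [OF assms(1-3)] by (simp add: Q_def g_def)
  qed (use assms(3) in auto)
  also have "\<dots> = 4 * ((\<alpha>\<^sup>2 * Q) * g)"
    by simp
  also have "\<dots> \<le> 4 * (1 / 16 * g)"
    using \<alpha>Q g1 by (intro mult_left_mono mult_right_mono) auto
  finally have B: "(sin \<alpha>)\<^sup>2 * (1 - c\<^sup>2) * (real N)\<^sup>2 \<le> g / 4"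
    by simp
  \<comment> \<open>This holds since 1/1024 + 1/4 is below 1/3.\<close>
  have "((1 - cos \<alpha>)\<^sup>2 + (sin \<alpha>)\<^sup>2 * (1 - c\<^sup>2)) * (real N)\<^sup>2 \<le> g / 3"
    using A B g1 by (simp add: distrib_right)
  then show ?thesis
    using N by (simp add: g_def power_divide field_simps)
qed

text \<open>The first component of a state is the number of Grover iterations of its branch, so step
  \<open>r\<close> acts on the branches \<open>t > r\<close> only; the last step also applies the sine transform.\<close>

definition threshold_step :: "nat \<Rightarrow> nat \<Rightarrow> nat \<Rightarrow> nat \<times> nat \<Rightarrow> nat \<times> nat \<Rightarrow> real" where
  "threshold_step N T r p q =
    (if Suc r = T then sine_vec T (fst p) (fst q) else if fst p = fst q then 1 else 0)
    * (if r < fst q then diffusion N (snd p) (snd q) else if snd p = snd q then 1 else 0)"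

text \<open>The step is a diffusion controlled by the time of the incoming state, followed by an
  orthogonal map of the time register. The sum factors accordingly: different times make the time
  factor vanish, and for equal times both columns meet the same block.\<close>

lemma threshold_step_orthonormal:
  assumes p: "p \<in> {1..T} \<times> {..<N}" and q: "q \<in> {1..T} \<times> {..<N}"
  shows "(\<Sum>k\<in>{1..T} \<times> {..<N}. threshold_step N T r k p * threshold_step N T r k q) = (if p = q then 1 else 0)"
proof -
  obtain t i s j where pq: "p = (t, i)" "q = (s, j)"
    by (cases p; cases q)
  define mix where "mix a t = (if Suc r = T then sine_vec T a t else if a = t then 1 else 0)" for a t
  define blk where "blk t a i = (if r < t then diffusion N a i else if a = i then 1 else 0)" for t a i
  have mix: "(\<Sum>a=1..T. mix a t * mix a s) = (if t = s then 1 else 0)"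
  proof (cases "Suc r = T")
    case True
    then have "mix a x = sine_vec T x a" for a x
      by (simp add: mix_def sine_vec_commute [of T a])
    then show ?thesis
      using sine_vec_orthonormal [of t T s] p q by (simp add: pq)
  next
    case False
    then have "(\<Sum>a=1..T. mix a t * mix a s) = (\<Sum>a=1..T. (if t = a then 1 else 0) * mix a s)"
      by (intro sum.cong) (auto simp: mix_def)
    also have "\<dots> = mix t s"
      using p by (intro sum_delta_mult) (auto simp: pq)
    finally show ?thesis
      using False by (simp add: mix_def)
  qed
  have blk: "(\<Sum>a<N. blk t a i * blk t a j) = (if i = j then 1 else 0)"
  proof (cases "r < t")
    case True
    then show ?thesis
      using diffusion_orthonormal [of i N j] p q by (simp add: blk_def pq)
  next
    case False
    then have "(\<Sum>a<N. blk t a i * blk t a j) = (\<Sum>a<N. (if i = a then 1 else 0) * blk t a j)"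
      by (intro sum.cong) (auto simp: blk_def)
    also have "\<dots> = blk t i j"
      using p by (intro sum_delta_mult) (auto simp: pq)
    finally show ?thesis
      using False by (simp add: blk_def)
  qed
  have "(\<Sum>k\<in>{1..T} \<times> {..<N}. threshold_step N T r k p * threshold_step N T r k q)
      = (\<Sum>a=1..T. \<Sum>b<N. (mix a t * mix a s) * (blk t b i * blk s b j))"
    unfolding sum.cartesian_product pq by (intro sum.cong refl) (auto simp: threshold_step_def mix_def blk_def)
  also have "\<dots> = (\<Sum>a=1..T. mix a t * mix a s) * (\<Sum>b<N. blk t b i * blk s b j)"
    by (simp only: sum_product)
  also have "\<dots> = (if p = q then 1 else 0)"
    unfolding mix pq using blk by auto
  finally show ?thesis .
qed

text \<open>Branch \<open>t\<close> stops after \<open>t\<close> iterations, whence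
  \<open>min r t\<close>. At time \<open>T\<close> every branch has stopped, and the last step has
  applied the sine transform.\<close>

lemma phase_state_threshold:
  assumes X: "length X = N" and "r < T" "t \<in> {1..T}" "i < N"
  shows "phase_state ({1..T} \<times> {..<N}) snd (\<lambda>r (t, i). r < t) (threshold_step N T)
      (\<lambda>(t, i). sine_vec T 1 t / sqrt (real N)) X r (t, i) = sine_vec T 1 t * grover X (min r t) i"
    (is "?S r (t, i) = _")
    and "phase_state ({1..T} \<times> {..<N}) snd (\<lambda>r (t, i). r < t) (threshold_step N T)
      (\<lambda>(t, i). sine_vec T 1 t / sqrt (real N)) X T (t, i) = final_amp X T t i"
proof -
  let ?mix = "\<lambda>r t' t. if Suc r = T then sine_vec T t' t else if t' = t then 1 else 0"
  \<comment> \<open>Stated with the time map still general, so that it covers both the ordinary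
    steps and the last one.\<close>
  have step: "?S (Suc r) (t', i') = (\<Sum>t=1..T. ?mix r t' t * (sine_vec T 1 t * grover X (min (Suc r) t) i'))"
    if IH: "\<And>t i. t \<in> {1..T} \<Longrightarrow> i < N \<Longrightarrow> ?S r (t, i) = sine_vec T 1 t * grover X (min r t) i"
      and i': "i' < N" for r t' i'
  proof -
    have blk: "(\<Sum>i<N. (if r < t then diffusion N i' i else if i' = i then 1 else 0)
        * ((if r < t \<and> X ! i then -1 else 1) * grover X (min r t) i)) = grover X (min (Suc r) t) i'" for t
    proof (cases "r < t")
      case True
      then have "min r t = r" "min (Suc r) t = Suc r"
        by auto
      with True X show ?thesis
        by (simp add: bit_sign_def)
    next
      case False
      then have "min r t = t" "min (Suc r) t = t"
        by auto
      with False i' show ?thesis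
        by (simp add: sum_delta_mult)
    qed
    have "?S (Suc r) (t', i') = (\<Sum>t=1..T. \<Sum>i<N. threshold_step N T r (t', i') (t, i)
        * (phase snd (\<lambda>r (t, i). r < t) X r (t, i) * ?S r (t, i)))"
      unfolding sum.cartesian_product by (simp add: case_prod_unfold)
    also have "\<dots> = (\<Sum>t=1..T. \<Sum>i<N. ?mix r t' t * sine_vec T 1 t
        * ((if r < t then diffusion N i' i else if i' = i then 1 else 0)
          * ((if r < t \<and> X ! i then -1 else 1) * grover X (min r t) i)))"
      using IH by (intro sum.cong refl) (simp add: threshold_step_def phase_def)
    also have "\<dots> = (\<Sum>t=1..T. ?mix r t' t * (sine_vec T 1 t * grover X (min (Suc r) t) i'))"
      unfolding sum_distrib_left [symmetric] blk by (simp only: mult.assoc)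
    finally show ?thesis .
  qed
  have before: "?S r (t, i) = sine_vec T 1 t * grover X (min r t) i"
    if "r < T" "t \<in> {1..T}" "i < N" for r t i
    using that
  proof (induction r arbitrary: t i)
    case 0
    then show ?case
      using X by simp
  next
    case (Suc r)
    then have "?S (Suc r) (t, i) = (\<Sum>s=1..T. ?mix r t s * (sine_vec T 1 s * grover X (min (Suc r) s) i))"
      by (intro step) auto
    also have "\<dots> = (\<Sum>s=1..T. (if t = s then 1 else 0) * (sine_vec T 1 s * grover X (min (Suc r) s) i))"
      using Suc.prems by simp
    also have "\<dots> = sine_vec T 1 t * grover X (min (Suc r) t) i"
      using Suc.prems by (intro sum_delta_mult) auto
    finally show ?case .
  qed
  then show "?S r (t, i) = sine_vec T 1 t * grover X (min r t) i"
    using assms by simp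
  obtain u where u: "T = Suc u"
    using assms(2) by (cases T) auto
  have "?S (Suc u) (t, i) = (\<Sum>s=1..T. ?mix u t s * (sine_vec T 1 s * grover X (min (Suc u) s) i))"
    using before assms u by (intro step) auto
  also have "\<dots> = (\<Sum>s=1..T. sine_vec T t s * (sine_vec T 1 s * grover X s i))"
    using u by (intro sum.cong refl) (simp add: min.absorb2 del: grover.simps)
  also have "\<dots> = final_amp X T t i"
    using assms by (simp only: final_amp_def)
  finally show "?S T (t, i) = final_amp X T t i"
    using u by simp
qed

text \<open>The network accepts when the measured eigenvalue lies below a cut. A wrong answer forces
  a deviation from \<open>c\<close> of at least the distance between \<open>c\<close> and the cut,
  and the variance is at most a third of that distance squared.\<close>

lemma threshold_upper_bound:
  assumes M: "1 \<le> M" "M \<le> N" and T: "T > 0"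
    and \<alpha>: "(pi / real (Suc T))\<^sup>2 * (16 * (real M * (real N - real M + 1))) \<le> 1"
  shows "\<exists>m U. quantum_network N m T U \<and> computes_bounded_error N (THRESHOLD M) m T U"
proof -
  define J where "J = {1..T} \<times> {..<N}"
  define lam where "lam p = cos (pi * real (fst p) / real (Suc T))" for p :: "nat \<times> nat"
  \<comment> \<open>The midpoint of \<open>1 - 2 * (M - 1) / N\<close> and
    \<open>1 - 2 * M / N\<close>, the cosines on the two sides of the threshold. More ones mean a
    smaller cosine, hence acceptance below the cut.\<close>
  define cut where "cut = 1 - (2 * real M - 1) / real N"
  define acc where "acc p = (lam p < cut)" for p
  define \<phi> where "\<phi> = (\<lambda>(t, i :: nat). sine_vec T 1 t / sqrt (real N))"
  let ?S = "phase_state J snd (\<lambda>r (t, i). r < t) (threshold_step N T) \<phi>"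
  have J: "finite J"
    by (simp add: J_def)
  have "(\<Sum>p\<in>J. (\<phi> p)\<^sup>2) = (\<Sum>t=1..T. \<Sum>i<N. (sine_vec T 1 t)\<^sup>2 / real N)"
    unfolding J_def sum.cartesian_product by (intro sum.cong refl) (auto simp: \<phi>_def power_divide)
  also have "\<dots> = (\<Sum>t=1..T. sine_vec T 1 t * sine_vec T 1 t)"
    using M by (intro sum.cong refl) (simp add: power2_eq_square)
  also have "\<dots> = 1"
    using T sine_vec_orthonormal [of 1 T 1] by simp
  finally have \<phi>: "(\<Sum>p\<in>J. (\<phi> p)\<^sup>2) = 1" .
  have "\<exists>m U. quantum_network N m T U \<and> (\<forall>X v. length X = N \<longrightarrow>
      output_prob m (network_state m U X T) v = (\<Sum>p | p \<in> J \<and> acc p = v. (?S X T p)\<^sup>2))"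
  proof (rule phase_algorithm_network [OF J _ \<phi>])
    show "snd p < N" if "p \<in> J" for p
      using that by (auto simp: J_def)
    show "(\<Sum>k\<in>J. threshold_step N T r k p * threshold_step N T r k q) = (if p = q then 1 else 0)"
      if "p \<in> J" "q \<in> J" for r p q
      using that unfolding J_def by (rule threshold_step_orthonormal)
  qed
  then obtain m U where mU: "quantum_network N m T U"
      "\<And>X v. length X = N \<Longrightarrow>
        output_prob m (network_state m U X T) v = (\<Sum>p | p \<in> J \<and> acc p = v. (?S X T p)\<^sup>2)"
    by blast
  have "output_prob m (network_state m U X T) (THRESHOLD M X) \<ge> 2 / 3" if X: "length X = N" for X
  proof -
    define k where "k = count_list X True"
    define f where "f = THRESHOLD M X"
    define c where "c = 1 - 2 * real k / real N"
    define g where "g = ((2 * real k - 2 * real M + 1) / real N)\<^sup>2"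
    have N: "N > 0"
      using M by simp
    have k: "k \<le> N"
      using X count_le_length [of X True] by (simp add: k_def)
    have c: "grover_cos X = c"
      using X by (simp add: grover_cos_def c_def k_def)
    have amp: "?S X T (t, i) = final_amp X T t i" if "(t, i) \<in> J" for t i
      using that phase_state_threshold(2) [OF X, of 0 T t i] T unfolding J_def \<phi>_def by simp
    have total: "(\<Sum>p\<in>J. (?S X T p)\<^sup>2) = 1"
    proof -
      have "(\<Sum>p\<in>J. (?S X T p)\<^sup>2) = (\<Sum>(t, i)\<in>J. (final_amp X T t i)\<^sup>2)"
        by (intro sum.cong refl) (auto simp: amp)
      also have "\<dots> = 1"
        unfolding J_def sum.cartesian_product [symmetric] using final_amp_norm [OF X N T] by simp
      finally show ?thesis .
    qed
    have "(\<Sum>p\<in>J. (lam p - c)\<^sup>2 * (?S X T p)\<^sup>2) = (\<Sum>(t, i)\<in>J. (lam (t, i) - c)\<^sup>2 * (final_amp X T t i)\<^sup>2)"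
      by (intro sum.cong refl) (auto simp: amp)
    also have "\<dots> \<le> (1 - cos (pi / real (Suc T)))\<^sup>2 + (sin (pi / real (Suc T)))\<^sup>2 * (1 - c\<^sup>2)"
      unfolding J_def sum.cartesian_product [symmetric]
      using final_amp_variance [OF X N T] by (simp only: lam_def c fst_conv)
    also have "\<dots> \<le> g / 3"
      unfolding g_def c_def using M k \<alpha> by (intro variance_small) auto
    finally have var: "(\<Sum>p\<in>J. (lam p - c)\<^sup>2 * (?S X T p)\<^sup>2) \<le> g / 3" .
    have cut: "cut - c = (2 * real k - 2 * real M + 1) / real N"
      using N by (simp add: cut_def c_def field_simps)
    have odd: "2 * real k - 2 * real M + 1 \<noteq> 0"
    proof
      assume "2 * real k - 2 * real M + 1 = 0"
      then have "real (2 * k + 1) = real (2 * M)"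
        by simp
      then have "2 * k + 1 = 2 * M"
        by (simp only: of_nat_eq_iff)
      then show False
        by presburger
    qed
    then have g: "g > 0"
      using N by (simp add: g_def)
    have far: "g \<le> (lam p - c)\<^sup>2" if "acc p \<noteq> f" for p
    proof (cases f)
      case True
      then have "M \<le> k"
        by (simp add: f_def THRESHOLD_def k_def)
      then have "0 \<le> cut - c"
        unfolding cut by simp
      moreover have "cut - c \<le> lam p - c"
        using that True by (simp add: acc_def)
      ultimately show ?thesis
        unfolding g_def cut [symmetric] by (rule power_mono [rotated])
    next
      case False
      then have "k < M"
        by (simp add: f_def THRESHOLD_def k_def)
      then have "(2 * real k - 2 * real M + 1) / real N \<le> 0"
        by (intro divide_nonpos_nonneg) auto
      then have "0 \<le> - (cut - c)"
        unfolding cut by simp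
      moreover have "- (cut - c) \<le> - (lam p - c)"
        using that False by (simp add: acc_def)
      ultimately have "(- (cut - c))\<^sup>2 \<le> (- (lam p - c))\<^sup>2"
        by (rule power_mono [rotated])
      then show ?thesis
        unfolding g_def cut [symmetric] by (simp only: power2_minus)
    qed
    have "(\<Sum>p | p \<in> J \<and> acc p \<noteq> f. (?S X T p)\<^sup>2) \<le> g / 3 / g"
      using far by (intro prob_wrong_side_le [OF J g _ _ _ var]) auto
    then have "(\<Sum>p | p \<in> J \<and> acc p \<noteq> f. (?S X T p)\<^sup>2) \<le> 1 / 3"
      using g by simp
    moreover have "(\<Sum>p\<in>J. (?S X T p)\<^sup>2)
        = (\<Sum>p | p \<in> J \<and> acc p = f. (?S X T p)\<^sup>2) + (\<Sum>p | p \<in> J \<and> acc p \<noteq> f. (?S X T p)\<^sup>2)"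
      using J by (subst sum.union_disjoint [symmetric]) (auto intro!: sum.cong)
    ultimately show ?thesis
      using total mU(2) [OF X, of f] by (simp add: f_def)
  qed
  with mU(1) show ?thesis
    unfolding computes_bounded_error_def by blast
qed

theorem mainTheorem6:
  shows "\<exists>c1 c2 :: real. c1 > 0 \<and> c2 > 0 \<and>
    (\<forall>N M :: nat. 1 \<le> M \<and> M \<le> N \<longrightarrow>
      c1 * sqrt (real M * (real N - real M + 1)) \<le> real (Q2 N (THRESHOLD M)) \<and>
      real (Q2 N (THRESHOLD M)) \<le> c2 * sqrt (real M * (real N - real M + 1)))"
\<comment> \<open>The 17 is 16 plus 1 for rounding up, absorbed because
  \<open>1 \<le> sqrt Q\<close>.\<close>
proof (rule exI [of _ "1 / 36"], rule exI [of _ 17], intro conjI allI impI)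
  fix N M :: nat
  assume "1 \<le> M \<and> M \<le> N"
  then have M: "1 \<le> M" "M \<le> N"
    by simp_all
  define Q where "Q = real M * (real N - real M + 1)"
  define T where "T = nat \<lceil>16 * sqrt Q\<rceil>"
  have Q1: "1 \<le> Q"
    unfolding Q_def using M mult_mono [of 1 "real M" 1 "real N - real M + 1"] by simp
  then have "1 \<le> sqrt Q"
    by simp
  have T: "16 * sqrt Q \<le> real T" "real T \<le> 16 * sqrt Q + 1"
    unfolding T_def using \<open>1 \<le> sqrt Q\<close> by linarith+
  then have "T > 0"
    using \<open>1 \<le> sqrt Q\<close> by (cases T) auto
  \<comment> \<open>With \<open>pi < 4\<close> the angle is at most \<open>1 / (4 * sqrt Q)\<close>,
    exactly what the hypothesis of \<open>threshold_upper_bound\<close> asks for; this fixes the 16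
    in \<open>T\<close>.\<close>
  have "pi / real (Suc T) \<le> 4 / (16 * sqrt Q)"
    using pi_less_4 T(1) \<open>1 \<le> sqrt Q\<close> by (intro frac_le) auto
  then have "(pi / real (Suc T))\<^sup>2 \<le> (4 / (16 * sqrt Q))\<^sup>2"
    by (intro power_mono) auto
  also have "\<dots> = 1 / (16 * Q)"
    using Q1 by (simp add: power_divide power_mult_distrib)
  finally have "(pi / real (Suc T))\<^sup>2 * (16 * Q) \<le> 1"
    using Q1 by (simp add: field_simps)
  then have ex: "\<exists>m U. quantum_network N m T U \<and> computes_bounded_error N (THRESHOLD M) m T U"
    using M \<open>T > 0\<close> by (intro threshold_upper_bound) (auto simp: Q_def)
  have "Q2 N (THRESHOLD M) \<le> T"
    unfolding Q2_def using ex by (rule Least_le)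
  then show "real (Q2 N (THRESHOLD M)) \<le> 17 * sqrt (real M * (real N - real M + 1))"
    using T(2) \<open>1 \<le> sqrt Q\<close> unfolding Q_def by linarith
  \<comment> \<open>The minimum defining \<open>Q2\<close> is attained because some network exists,
    so the lower bound also rests on the construction above.\<close>
  have "\<exists>m U. quantum_network N m (Q2 N (THRESHOLD M)) U
      \<and> computes_bounded_error N (THRESHOLD M) m (Q2 N (THRESHOLD M)) U"
    unfolding Q2_def by (rule LeastI) (rule ex)
  then have lower: "sqrt (real ((N - (M - 1)) * M)) / 36 \<le> real (Q2 N (THRESHOLD M))"
    using M threshold_lower_bound by blast
  have Q': "real ((N - (M - 1)) * M) = real M * (real N - real M + 1)"
    using M by (simp add: of_nat_diff)
  from lower [unfolded Q'] show "1 / 36 * sqrt (real M * (real N - real M + 1)) \<le> real (Q2 N (THRESHOLD M))"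
    by simp
qed simp_all

end
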